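(* There exists a set $G\subseteq \omega\times\omega$ with $\mathrm{wt}(G)<\infty$ such that for every c.e. set $D\subseteq\omega\times\omega$ with $\mathrm{wt}(D)<\infty$ we have $D\subseteq^* G$ (i.e. $D\setminus G$ is finite), and $G$ does not Turing-compute any $1$-random (Martin-Löf random) real.
   Context: For $X\subseteq\omega\times\omega$, the weight of $X$ is $\mathrm{wt}(X)=\sum_{(n,m)\in X}2^{-n}$. A c.e. set $D\subseteq\omega\times\omega$ with $\mathrm{wt}(D)<\infty$ is called a c.e. discrete covering (DC) instance. *)

theory Defs
  imports "HOL-Probability.Probability" "HOL-Library.Nat_Bijection"
begin

datatype rf = Zero | Succ | Fst | Snd | Orc
  | Comp rf rf
  | Pair rf rf
  | Prec rf rf
  | Mu rf

inductive eval :: "(nat \<Rightarrow> bool) \<Rightarrow> rf \<Rightarrow> nat \<Rightarrow> nat \<Rightarrow> bool" for A where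
  "eval A Zero x 0"
| "eval A Succ x (Suc x)"
| "eval A Fst x (fst (prod_decode x))"
| "eval A Snd x (snd (prod_decode x))"
| "eval A Orc x (if A x then 1 else 0)"
| "eval A g x y \<Longrightarrow> eval A f y z \<Longrightarrow> eval A (Comp f g) x z"
| "eval A f x y \<Longrightarrow> eval A g x z \<Longrightarrow> eval A (Pair f g) x (prod_encode (y, z))"
| "eval A f a y \<Longrightarrow> eval A (Prec f g) (prod_encode (a, 0)) y"
| "eval A (Prec f g) (prod_encode (a, n)) y \<Longrightarrow>
   eval A g (prod_encode (a, prod_encode (n, y))) z \<Longrightarrow>
   eval A (Prec f g) (prod_encode (a, Suc n)) z"
| "eval A f (prod_encode (a, n)) 0 \<Longrightarrow>
   (\<forall>m<n. \<exists>y. y \<noteq> 0 \<and> eval A f (prod_encode (a, m)) y) \<Longrightarrow>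
   eval A (Mu f) a n"

definition ce :: "nat set \<Rightarrow> bool" where
  "ce W \<longleftrightarrow> (\<exists>p. \<forall>x. x \<in> W \<longleftrightarrow> (\<exists>y. eval (\<lambda>_. False) p x y))"

definition ce_pairs :: "(nat \<times> nat) set \<Rightarrow> bool" where
  "ce_pairs D \<longleftrightarrow> ce (prod_encode ` D)"

definition pair_oracle :: "(nat \<times> nat) set \<Rightarrow> nat \<Rightarrow> bool" where
  "pair_oracle G x \<longleftrightarrow> prod_decode x \<in> G"

definition turing_computes :: "(nat \<times> nat) set \<Rightarrow> (nat \<Rightarrow> bool) \<Rightarrow> bool" where
  "turing_computes G X \<longleftrightarrow>
     (\<exists>p. \<forall>n. eval (pair_oracle G) p n (if X n then 1 else 0))"

definition wt :: "(nat \<times> nat) set \<Rightarrow> ennreal" where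
  "wt X = (\<Sum>\<^sub>\<infinity>(n, m)\<in>X. ennreal ((1/2) ^ n))"

definition code_str :: "bool list \<Rightarrow> nat" where
  "code_str \<sigma> = list_encode (map of_bool \<sigma>)"

definition cantor :: "(nat \<Rightarrow> bool) measure" where
  "cantor = (\<Pi>\<^sub>M i\<in>(UNIV :: nat set). measure_pmf (bernoulli_pmf (1/2)))"

definition cyl :: "bool list set \<Rightarrow> (nat \<Rightarrow> bool) set" where
  "cyl U = {X. \<exists>\<sigma>\<in>U. \<forall>i<length \<sigma>. X i = \<sigma> ! i}"

definition mlof_test :: "(nat \<Rightarrow> bool list set) \<Rightarrow> bool" where
  "mlof_test U \<longleftrightarrow> ce {prod_encode (n, code_str \<sigma>) | n \<sigma>. \<sigma> \<in> U n}
     \<and> (\<forall>n. emeasure cantor (cyl (U n)) \<le> ennreal ((1/2) ^ n))"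

definition mlof_random :: "(nat \<Rightarrow> bool) \<Rightarrow> bool" where
  "mlof_random X \<longleftrightarrow> \<not> (\<exists>U. mlof_test U \<and> (\<forall>n. X \<in> cyl (U n)))"

end

theory Submission
  imports Defs
begin

text \<open>
  Sets of pairs are identified with sets of codes. The set \<open>G\<close> is built by forcing with \<open>\<Pi>\<^sup>0\<^sub>1\<close> classes that are
  fat: they contain a ball, that is all \<open>G\<close> extending some core \<open>K\<close> of finite weight, equal to \<open>K\<close> below \<open>N\<close> and with
  \<open>G - K\<close> of weight at most \<open>\<eta> > 0\<close>. Adding a tail of a c.e. set of finite weight keeps a class fat.

  Given a functional, if some fat subclass forces it to diverge, pass to that subclass. Otherwise every ball inside
  the class contains a set on which the functional converges on any prescribed initial segment. Restrict to cores whose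
  weight is within \<open>\<delta>\<close> of the least possible. Call a finite set \<open>T\<close> of strings large if above every such core the output
  can be steered into \<open>T\<close>. A large \<open>T\<close> can be shrunk by the factor \<open>3/4\<close> at an expense of \<open>3 \<delta>\<close> in weight, by imposing
  \<open>\<not> (X i \<and> \<not> X j)\<close> for suitable new positions \<open>i < j\<close>: if a core \<open>K i j\<close> blocked this for all \<open>i < j\<close>, then, since the
  shift graph has no finite colouring, \<open>K i j\<close> and \<open>K j k\<close> would agree on a long prefix for some \<open>i < j < k\<close>; their
  union is a core up to small weight, and an output above it would satisfy \<open>X i \<and> \<not> X j\<close> and \<open>X j \<and> \<not> X k\<close>.
  After \<open>9 h\<close> steps \<open>T\<close> has measure at most \<open>2^(-3h)\<close>, while guessing the least weight up to \<open>\<delta> = 2^(-h)\<close> takes only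
  \<open>2^(2h)\<close> attempts. By compactness largeness is \<open>\<Sigma>\<^sup>0\<^sub>1\<close>, so searching for large sets for all conditions and guesses gives
  a Martin-Loef test that captures the output.
\<close>

section \<open>Computable functions and Sigma-1 predicates\<close>

abbreviation cpair :: "nat \<Rightarrow> nat \<Rightarrow> nat" ("\<langle>_,_\<rangle>") where "\<langle>a,b\<rangle> \<equiv> prod_encode (a, b)"
abbreviation pi1 :: "nat \<Rightarrow> nat" where "pi1 x \<equiv> fst (prod_decode x)"
abbreviation pi2 :: "nat \<Rightarrow> nat" where "pi2 x \<equiv> snd (prod_decode x)"

definition cpt :: "(nat \<Rightarrow> nat) \<Rightarrow> bool" where
  "cpt f \<longleftrightarrow> (\<exists>p. \<forall>x. eval (\<lambda>_. False) p x (f x))"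

definition dec :: "(nat \<Rightarrow> bool) \<Rightarrow> bool" where
  "dec P \<longleftrightarrow> cpt (\<lambda>x. of_bool (P x))"

definition sig :: "(nat \<Rightarrow> bool) \<Rightarrow> bool" where
  "sig P \<longleftrightarrow> (\<exists>R. dec R \<and> (\<forall>x. P x \<longleftrightarrow> (\<exists>y. R \<langle>x,y\<rangle>)))"

inductive_cases eval_ZeroE: "eval A Zero x y"
inductive_cases eval_SuccE: "eval A Succ x y"
inductive_cases eval_FstE: "eval A Fst x y"
inductive_cases eval_SndE: "eval A Snd x y"
inductive_cases eval_OrcE: "eval A Orc x y"
inductive_cases eval_CompE: "eval A (Comp f g) x y"
inductive_cases eval_PairE: "eval A (Pair f g) x y"
inductive_cases eval_PrecE: "eval A (Prec f g) x y"
inductive_cases eval_MuE: "eval A (Mu f) x y"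

lemma eval_det: "eval A p x y \<Longrightarrow> eval A p x z \<Longrightarrow> y = z"
proof (induction arbitrary: z rule: eval.induct)
  case (6 g x y f z')
  from 6(5) show ?case by (rule eval_CompE) (use 6 in blast)
next
  case (7 f x y g z')
  from 7(5) show ?case by (rule eval_PairE) (use 7 in blast)
next
  case (8 f a y g)
  from 8(3) show ?case by (rule eval_PrecE) (use 8(2) in simp_all)
next
  case (9 f g a n y z')
  from 9(5) show ?case
  proof (rule eval_PrecE)
    fix a' n' y'
    assume *: "\<langle>a,Suc n\<rangle> = \<langle>a',Suc n'\<rangle>" "eval A (Prec f g) \<langle>a',n'\<rangle> y'" "eval A g \<langle>a',\<langle>n',y'\<rangle>\<rangle> z"
    hence "a' = a" "n' = n" by simp_all
    thus "z' = z" using 9(3)[of y'] 9(4)[of z] * by simp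
  qed simp
next
  case (10 f a n)
  have *: "eval A f \<langle>a,z\<rangle> 0 \<and> (\<forall>m<z. \<exists>y. y \<noteq> 0 \<and> eval A f \<langle>a,m\<rangle> y)"
    using 10(4) by (rule eval_MuE) simp
  have "\<not> n < z" using * 10(2) by metis
  moreover have "\<not> z < n" using * 10(3) by metis
  ultimately show ?case by simp
qed (auto elim: eval_ZeroE eval_SuccE eval_FstE eval_SndE eval_OrcE)

section \<open>Closure of the computable functions\<close>

lemma cpt_comp: "cpt f \<Longrightarrow> cpt g \<Longrightarrow> cpt (\<lambda>x. f (g x))"
  unfolding cpt_def by (metis eval.intros(6))

lemma cpt_pair: "cpt f \<Longrightarrow> cpt g \<Longrightarrow> cpt (\<lambda>x. \<langle>f x, g x\<rangle>)"
  unfolding cpt_def by (metis eval.intros(7))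

lemma cpt_fst0: "cpt (\<lambda>x. pi1 x)"
  unfolding cpt_def by (metis eval.intros(3))

lemma cpt_snd0: "cpt (\<lambda>x. pi2 x)"
  unfolding cpt_def by (metis eval.intros(4))

text \<open>The language has no identity program; pairing the two projections supplies one, as every
  number codes a pair.\<close>

lemma cpt_id: "cpt (\<lambda>x. x)"
  using cpt_pair[OF cpt_fst0 cpt_snd0] by simp

lemma cpt_fst: "cpt f \<Longrightarrow> cpt (\<lambda>x. pi1 (f x))"
  by (rule cpt_comp[OF cpt_fst0])

lemma cpt_snd: "cpt f \<Longrightarrow> cpt (\<lambda>x. pi2 (f x))"
  by (rule cpt_comp[OF cpt_snd0])

lemma cpt_Suc: "cpt f \<Longrightarrow> cpt (\<lambda>x. Suc (f x))"
  using cpt_comp[of Suc f] unfolding cpt_def by (metis eval.intros(2))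

lemma cpt_const: "cpt (\<lambda>x. c)"
proof (induction c)
  case 0
  show ?case unfolding cpt_def by (metis eval.intros(1))
qed (rule cpt_Suc)

lemma cpt_rec0:
  assumes "cpt a" "cpt g"
  shows "cpt (\<lambda>x. rec_nat (a (pi1 x)) (\<lambda>n y. g \<langle>pi1 x,\<langle>n,y\<rangle>\<rangle>) (pi2 x))"
proof -
  obtain p q where p: "\<And>x. eval (\<lambda>_. False) p x (a x)" and q: "\<And>x. eval (\<lambda>_. False) q x (g x)"
    using assms unfolding cpt_def by blast
  have "eval (\<lambda>_. False) (Prec p q) \<langle>x,n\<rangle> (rec_nat (a x) (\<lambda>n y. g \<langle>x,\<langle>n,y\<rangle>\<rangle>) n)" for x n
  proof (induction n)
    case 0
    show ?case using eval.intros(8)[OF p] by simp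
  next
    case (Suc n)
    show ?case using eval.intros(9)[OF Suc q] by simp
  qed
  from this[of "pi1 x" "pi2 x" for x]
  have "eval (\<lambda>_. False) (Prec p q) x (rec_nat (a (pi1 x)) (\<lambda>n y. g \<langle>pi1 x,\<langle>n,y\<rangle>\<rangle>) (pi2 x))" for x
    by simp
  thus ?thesis unfolding cpt_def by blast
qed

text \<open>The whole input \<open>x\<close> serves as the parameter of the recursion, so
  \<open>a\<close>, \<open>g\<close> and \<open>k\<close> may all depend on it. The arithmetic
  operations and finite sums below are instances.\<close>

lemma cpt_rec:
  assumes "cpt a" "cpt (\<lambda>z. g (pi1 z) (pi1 (pi2 z)) (pi2 (pi2 z)))" "cpt k"
  shows "cpt (\<lambda>x. rec_nat (a x) (\<lambda>n y. g x n y) (k x))"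
  using cpt_comp[OF cpt_rec0[OF assms(1,2)] cpt_pair[OF cpt_id assms(3)]] by simp

lemma cpt_add: assumes "cpt f" "cpt g" shows "cpt (\<lambda>x. f x + g x)"
proof -
  have "rec_nat a (\<lambda>n y. Suc y) k = a + k" for a k by (induction k) auto
  thus ?thesis using cpt_rec[OF assms(1) _ assms(2), of "\<lambda>x n y. Suc y"]
    by (simp add: cpt_Suc cpt_snd cpt_id)
qed

lemma cpt_mult: assumes "cpt f" "cpt g" shows "cpt (\<lambda>x. f x * g x)"
proof -
  have "rec_nat 0 (\<lambda>n y. y + a) k = a * k" for a k :: nat by (induction k) auto
  thus ?thesis using cpt_rec[OF cpt_const[of 0] _ assms(2), of "\<lambda>x n y. y + f x"]
    by (simp add: cpt_add cpt_snd cpt_fst cpt_id cpt_comp[OF assms(1)])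
qed

lemma cpt_pow: assumes "cpt f" "cpt g" shows "cpt (\<lambda>x. f x ^ g x)"
proof -
  have "rec_nat (Suc 0) (\<lambda>n y. y * a) k = a ^ k" for a k :: nat by (induction k) auto
  thus ?thesis using cpt_rec[OF cpt_const[of 1] _ assms(2), of "\<lambda>x n y. y * f x"]
    by (simp add: cpt_mult cpt_snd cpt_fst cpt_id cpt_comp[OF assms(1)])
qed

lemma cpt_pred: assumes "cpt f" shows "cpt (\<lambda>x. f x - 1)"
proof -
  have "rec_nat 0 (\<lambda>n y. n) k = k - Suc 0" for k :: nat by (induction k) auto
  thus ?thesis using cpt_rec[OF cpt_const[of 0] _ assms, of "\<lambda>x n y. n"]
    by (simp add: cpt_snd cpt_fst cpt_id)
qed

lemma cpt_diff: assumes "cpt f" "cpt g" shows "cpt (\<lambda>x. f x - g x)"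
proof -
  have "rec_nat a (\<lambda>n y. y - 1) k = a - k" for a k :: nat by (induction k) auto
  thus ?thesis using cpt_rec[OF assms(1) _ assms(2), of "\<lambda>x n y. y - 1"]
    using cpt_pred[OF cpt_snd[OF cpt_snd[OF cpt_id]]] by simp
qed

lemma cpt_sum:
  assumes "cpt b" "cpt (\<lambda>z. g (pi1 z) (pi2 z))"
  shows "cpt (\<lambda>x. \<Sum>i<b x. g x i)"
proof -
  have eq: "(\<Sum>i<k. g x i) = rec_nat 0 (\<lambda>n y. y + g x n) k" for x k
    by (induction k) auto
  have "cpt (\<lambda>z. (pi2 (pi2 z)) + g (pi1 z) (pi1 (pi2 z)))"
    using cpt_comp[OF assms(2), of "\<lambda>z. \<langle>pi1 z, pi1 (pi2 z)\<rangle>"]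
    by (intro cpt_add cpt_snd cpt_id) (simp add: cpt_pair cpt_fst cpt_snd cpt_id)
  from cpt_rec[OF cpt_const[of 0] this assms(1)] show ?thesis by (simp add: eq)
qed

lemma cpt_of_bool: "dec P \<Longrightarrow> cpt (\<lambda>x. of_bool (P x))"
  by (simp add: dec_def)

lemmas cpt_intros = cpt_id cpt_const cpt_pair cpt_fst cpt_snd cpt_Suc cpt_add cpt_mult cpt_pow
  cpt_diff cpt_sum cpt_of_bool

section \<open>Decidable predicates\<close>

lemma dec_subst: "dec P \<Longrightarrow> cpt f \<Longrightarrow> dec (\<lambda>x. P (f x))"
  unfolding dec_def by (rule cpt_comp)

lemma dec_le: "cpt f \<Longrightarrow> cpt g \<Longrightarrow> dec (\<lambda>x. f x \<le> g x)"
proof -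
  assume "cpt f" "cpt g"
  hence "cpt (\<lambda>x. 1 - (f x - g x))" by (intro cpt_intros)
  moreover have "(\<lambda>x. 1 - (f x - g x)) = (\<lambda>x. of_bool (f x \<le> g x))" by (auto simp: fun_eq_iff)
  ultimately show ?thesis by (simp add: dec_def)
qed

lemma dec_less: "cpt f \<Longrightarrow> cpt g \<Longrightarrow> dec (\<lambda>x. f x < g x)"
  using dec_le[of "\<lambda>x. Suc (f x)" g] by (simp add: cpt_Suc Suc_le_eq)

lemma dec_not: "dec P \<Longrightarrow> dec (\<lambda>x. \<not> P x)"
proof -
  assume "dec P"
  hence "cpt (\<lambda>x. 1 - of_bool (P x))" by (intro cpt_intros)
  moreover have "(\<lambda>x. 1 - of_bool (P x)) = (\<lambda>x. of_bool (\<not> P x) :: nat)" by (auto simp: fun_eq_iff)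
  ultimately show ?thesis by (simp add: dec_def)
qed

lemma dec_conj: "dec P \<Longrightarrow> dec Q \<Longrightarrow> dec (\<lambda>x. P x \<and> Q x)"
proof -
  assume "dec P" "dec Q"
  hence "cpt (\<lambda>x. of_bool (P x) * of_bool (Q x))" by (intro cpt_intros)
  thus ?thesis by (simp add: dec_def of_bool_conj)
qed

lemma dec_disj: "dec P \<Longrightarrow> dec Q \<Longrightarrow> dec (\<lambda>x. P x \<or> Q x)"
  using dec_not[OF dec_conj[OF dec_not dec_not], of P Q] by simp

lemma dec_imp: "dec P \<Longrightarrow> dec Q \<Longrightarrow> dec (\<lambda>x. P x \<longrightarrow> Q x)"
  using dec_disj[OF dec_not, of P Q] by (simp only: imp_conv_disj)

lemma dec_eq: "cpt f \<Longrightarrow> cpt g \<Longrightarrow> dec (\<lambda>x. f x = g x)"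
  using dec_conj[OF dec_le dec_le, of f g g f] by (simp only: order_eq_iff)

lemma dec_iff: "dec P \<Longrightarrow> dec Q \<Longrightarrow> dec (\<lambda>x. P x \<longleftrightarrow> Q x)"
  using dec_conj[OF dec_imp dec_imp, of P Q Q P] by (simp only: iff_conv_conj_imp)

text \<open>Bounded quantification reduces to a finite sum: the number of counterexamples below the
  bound must be 0.\<close>

lemma dec_ball:
  assumes "cpt b" "dec (\<lambda>z. P (pi1 z) (pi2 z))"
  shows "dec (\<lambda>x. \<forall>i<b x. P x i)"
proof -
  have eq: "(\<forall>i<k. P x i) \<longleftrightarrow> (\<Sum>i<k. of_bool (\<not> P x i)) = (0::nat)" for x k
    by auto
  show ?thesis unfolding eq using assms by (intro dec_eq cpt_intros dec_not)
qed

lemma dec_bex: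
  assumes "cpt b" "dec (\<lambda>z. P (pi1 z) (pi2 z))"
  shows "dec (\<lambda>x. \<exists>i<b x. P x i)"
  using dec_not[OF dec_ball[OF assms(1) dec_not[OF assms(2)]]] by simp

lemma dec_const: "dec (\<lambda>x. c)"
  unfolding dec_def by (rule cpt_const)

lemmas dec_intros0 = dec_const dec_le dec_less dec_not dec_conj dec_disj dec_imp dec_eq dec_iff dec_ball dec_bex

text \<open>Bit \<open>k\<close> of \<open>u\<close> is set iff
  \<open>u = (2 * q + 1) * 2 ^ k + r\<close> for some \<open>r < 2 ^ k\<close>. With
  \<open>q\<close> bounded by \<open>u\<close> this is a bounded search, which spares a proof that
  division is computable.\<close>

lemma dec_mem: 
  assumes "cpt f" "cpt g" shows "dec (\<lambda>x. f x \<in> set_decode (g x))"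
proof -
  have "odd (u div 2 ^ k) \<longleftrightarrow> (\<exists>q<Suc u. \<exists>r<2^k. u = (2 * q + 1) * 2 ^ k + r)" for u k :: nat
  proof
    assume "odd (u div 2 ^ k)"
    then obtain q where q: "u div 2 ^ k = 2 * q + 1" by (elim oddE)
    have "u = (2 * q + 1) * 2 ^ k + u mod 2 ^ k" using q by (metis div_mult_mod_eq)
    moreover have "q < Suc u" using q by (metis add_leE div_le_dividend le_add1 le_imp_less_Suc mult_2 order_trans)
    ultimately show "\<exists>q<Suc u. \<exists>r<2^k. u = (2 * q + 1) * 2 ^ k + r"
      by (metis mod_less_divisor pos2 zero_less_power)
  next
    assume "\<exists>q<Suc u. \<exists>r<2^k. u = (2 * q + 1) * 2 ^ k + r"
    then obtain q r where "r < 2 ^ k" "u = (2 * q + 1) * 2 ^ k + r" by blast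
    hence "u div 2 ^ k = 2 * q + 1" by (metis add.commute add_0 div_less div_mult_self3 power_not_zero zero_neq_numeral)
    thus "odd (u div 2 ^ k)" by simp
  qed
  hence "(\<lambda>x. f x \<in> set_decode (g x)) = (\<lambda>x. \<exists>q<Suc (g x). \<exists>r<2^(f x). g x = (2 * q + 1) * 2 ^ (f x) + r)"
    by (auto simp: set_decode_def fun_eq_iff)
  moreover have "dec \<dots>"
    by (intro dec_intros0 cpt_intros cpt_comp[OF assms(1)] cpt_comp[OF assms(2)])
  ultimately show ?thesis by simp
qed

lemmas dec_intros = dec_intros0 dec_mem

section \<open>Sigma-1 predicates\<close>

lemma sig_dec: "dec P \<Longrightarrow> sig P"
  unfolding sig_def by (rule exI[of _ "\<lambda>z. P (pi1 z)"]) (simp add: dec_subst[OF _ cpt_fst0])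

lemma sig_subst: assumes "sig P" "cpt f" shows "sig (\<lambda>x. P (f x))"
proof -
  obtain R where R: "dec R" "\<And>x. P x \<longleftrightarrow> (\<exists>y. R \<langle>x,y\<rangle>)" using assms unfolding sig_def by blast
  have "dec (\<lambda>z. R \<langle>f (pi1 z), pi2 z\<rangle>)"
    by (intro dec_subst[OF R(1)] cpt_intros cpt_comp[OF assms(2)])
  thus ?thesis unfolding sig_def using R(2) by (intro exI[of _ "\<lambda>z. R \<langle>f (pi1 z), pi2 z\<rangle>"]) simp
qed

lemma sig_ex: assumes "sig (\<lambda>z. P (pi1 z) (pi2 z))" shows "sig (\<lambda>x. \<exists>y. P x y)"
proof -
  obtain R where R: "dec R" "\<And>z. P (pi1 z) (pi2 z) \<longleftrightarrow> (\<exists>y. R \<langle>z,y\<rangle>)" 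
    using assms unfolding sig_def by blast
  have R2: "P x y \<longleftrightarrow> (\<exists>t. R \<langle>\<langle>x,y\<rangle>,t\<rangle>)" for x y using R(2)[of "\<langle>x,y\<rangle>"] by simp
  have "dec (\<lambda>z. R \<langle>\<langle>pi1 z, pi1 (pi2 z)\<rangle>, pi2 (pi2 z)\<rangle>)"
    by (intro dec_subst[OF R(1)] cpt_intros)
  moreover have "(\<exists>y. P x y) \<longleftrightarrow> (\<exists>y. R \<langle>\<langle>x, pi1 y\<rangle>, pi2 y\<rangle>)" for x
    unfolding R2 by (metis fst_conv prod_encode_inverse snd_conv)
  ultimately show ?thesis unfolding sig_def
    by (intro exI[of _ "\<lambda>z. R \<langle>\<langle>pi1 z, pi1 (pi2 z)\<rangle>, pi2 (pi2 z)\<rangle>"]) simp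
qed

lemma sig_conj: assumes "sig P" "sig Q" shows "sig (\<lambda>x. P x \<and> Q x)"
proof -
  obtain R where R: "dec R" "\<And>x. P x \<longleftrightarrow> (\<exists>y. R \<langle>x,y\<rangle>)" using assms unfolding sig_def by blast
  obtain S where S: "dec S" "\<And>x. Q x \<longleftrightarrow> (\<exists>y. S \<langle>x,y\<rangle>)" using assms unfolding sig_def by blast
  have "sig (\<lambda>x. \<exists>y. \<exists>z. R \<langle>x,y\<rangle> \<and> S \<langle>x,z\<rangle>)"
    by (intro sig_ex sig_dec dec_intros dec_subst[OF R(1)] dec_subst[OF S(1)] cpt_intros)
  thus ?thesis using R(2) S(2) by simp
qed

lemma sig_disj: assumes "sig P" "sig Q" shows "sig (\<lambda>x. P x \<or> Q x)"
proof -
  obtain R where R: "dec R" "\<And>x. P x \<longleftrightarrow> (\<exists>y. R \<langle>x,y\<rangle>)" using assms unfolding sig_def by blast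
  obtain S where S: "dec S" "\<And>x. Q x \<longleftrightarrow> (\<exists>y. S \<langle>x,y\<rangle>)" using assms unfolding sig_def by blast
  have "sig (\<lambda>x. \<exists>y. R \<langle>x,y\<rangle> \<or> S \<langle>x,y\<rangle>)"
    by (intro sig_ex sig_dec dec_intros dec_subst[OF R(1)] dec_subst[OF S(1)] cpt_intros)
  thus ?thesis using R(2) S(2) by (simp add: ex_disj_distrib)
qed

lemma sig_imp: "dec P \<Longrightarrow> sig Q \<Longrightarrow> sig (\<lambda>x. P x \<longrightarrow> Q x)"
  using sig_disj[OF sig_dec[OF dec_not], of P Q] by (simp only: imp_conv_disj)

text \<open>Collection: the finitely many witnesses have a common bound \<open>B\<close>, for
  instance one more than their sum, so the unbounded quantifier moves to the front.\<close>

lemma sig_ball: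
  assumes "cpt b" "sig (\<lambda>z. P (pi1 z) (pi2 z))"
  shows "sig (\<lambda>x. \<forall>i<b x. P x i)"
proof -
  obtain R where R: "dec R" "\<And>z. P (pi1 z) (pi2 z) \<longleftrightarrow> (\<exists>y. R \<langle>z,y\<rangle>)" 
    using assms unfolding sig_def by blast
  have R2: "P x y \<longleftrightarrow> (\<exists>t. R \<langle>\<langle>x,y\<rangle>,t\<rangle>)" for x y using R(2)[of "\<langle>x,y\<rangle>"] by simp
  have "(\<forall>i<k. P x i) \<longleftrightarrow> (\<exists>B. \<forall>i<k. \<exists>t<B. R \<langle>\<langle>x,i\<rangle>,t\<rangle>)" for x k
  proof
    assume "\<forall>i<k. P x i"
    then obtain f where f: "\<And>i. i < k \<Longrightarrow> R \<langle>\<langle>x,i\<rangle>,f i\<rangle>" unfolding R2 by metis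
    have "f i < Suc (\<Sum>j<k. f j)" if "i < k" for i
      using that by (simp add: le_imp_less_Suc member_le_sum)
    thus "\<exists>B. \<forall>i<k. \<exists>t<B. R \<langle>\<langle>x,i\<rangle>,t\<rangle>" using f by blast
  qed (use R2 in blast)
  moreover have "sig (\<lambda>x. \<exists>B. \<forall>i<b x. \<exists>t<B. R \<langle>\<langle>x,i\<rangle>,t\<rangle>)"
    by (intro sig_ex sig_dec dec_intros dec_subst[OF R(1)] cpt_intros cpt_comp[OF assms(1)])
  ultimately show ?thesis by simp
qed

text \<open>The least pair of a value and a witness selects one value.\<close>
lemma sig_uniformize:
  assumes "sig (\<lambda>z. P (pi1 z) (pi2 z))"
  obtains Q where "sig (\<lambda>z. Q (pi1 z) (pi2 z))" "\<And>x y. Q x y \<Longrightarrow> P x y"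
    "\<And>x y y'. Q x y \<Longrightarrow> Q x y' \<Longrightarrow> y = y'" "\<And>x y. P x y \<Longrightarrow> \<exists>y'. Q x y'"
proof -
  obtain R where R: "dec R" "\<And>z. P (pi1 z) (pi2 z) \<longleftrightarrow> (\<exists>y. R \<langle>z,y\<rangle>)" 
    using assms unfolding sig_def by blast
  have R2: "P x y \<longleftrightarrow> (\<exists>t. R \<langle>\<langle>x,y\<rangle>,t\<rangle>)" for x y using R(2)[of "\<langle>x,y\<rangle>"] by simp
  define S where "S x m \<longleftrightarrow> R \<langle>\<langle>x,pi1 m\<rangle>,pi2 m\<rangle>" for x m
  define Q where "Q x y \<longleftrightarrow> (\<exists>m. S x m \<and> (\<forall>m'<m. \<not> S x m') \<and> y = pi1 m)" for x y
  have "sig (\<lambda>z. Q (pi1 z) (pi2 z))" unfolding Q_def S_def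
    by (intro sig_ex sig_dec dec_intros dec_subst[OF R(1)] cpt_intros)
  moreover have "P x y" if "Q x y" for x y using that unfolding Q_def S_def R2 by blast
  moreover have "y = y'" if "Q x y" "Q x y'" for x y y'
    using that unfolding Q_def by (metis nat_neq_iff)
  moreover have "\<exists>y'. Q x y'" if "P x y" for x y
  proof -
    obtain t where "S x \<langle>y,t\<rangle>" using \<open>P x y\<close> unfolding R2 S_def by auto
    hence "\<exists>m. S x m \<and> (\<forall>m'<m. \<not> S x m')" by (meson exists_least_iff)
    thus ?thesis unfolding Q_def by blast
  qed
  ultimately show thesis by (rule that)
qed

lemma sig_imp_ce: assumes "sig P" shows "ce {x. P x}"
proof -
  obtain R where R: "dec R" "\<And>x. P x \<longleftrightarrow> (\<exists>y. R \<langle>x,y\<rangle>)" using assms unfolding sig_def by blast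
  \<comment> \<open>\<open>Mu\<close> searches for the value 0, so the program has to return 0
    exactly on the witnesses; hence the negation.\<close>
  have "dec (\<lambda>x. \<not> R x)" using R(1) by (rule dec_not)
  then obtain p where p: "\<And>x. eval (\<lambda>_. False) p x (of_bool (\<not> R x))" unfolding dec_def cpt_def by blast
  have rel: "eval A q x y \<Longrightarrow> q = Mu f \<Longrightarrow> eval A f \<langle>x,y\<rangle> 0" for A q f x y
    by (induction rule: eval.induct) auto
  have det: "eval (\<lambda>_. False) p x y \<Longrightarrow> y = of_bool (\<not> R x)" for x y using eval_det[OF _ p] .
  have "P x \<longleftrightarrow> (\<exists>y. eval (\<lambda>_. False) (Mu p) x y)" for x
  proof
    assume "P x"
    hence "\<exists>y. R \<langle>x,y\<rangle> \<and> (\<forall>m<y. \<not> R \<langle>x,m\<rangle>)" unfolding R by (meson exists_least_iff)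
    then obtain y where y: "R \<langle>x,y\<rangle>" "\<And>m. m<y \<Longrightarrow> \<not> R \<langle>x,m\<rangle>" by blast
    have "eval (\<lambda>_. False) p \<langle>x,y\<rangle> 0" using p[of "\<langle>x,y\<rangle>"] y(1) by simp
    moreover have "eval (\<lambda>_. False) p \<langle>x,m\<rangle> 1" if "m < y" for m using p[of "\<langle>x,m\<rangle>"] y(2)[OF that] by simp
    ultimately show "\<exists>y. eval (\<lambda>_. False) (Mu p) x y" by (metis eval.intros(10) zero_neq_one)
  next
    assume "\<exists>y. eval (\<lambda>_. False) (Mu p) x y"
    then obtain y where "eval (\<lambda>_. False) p \<langle>x,y\<rangle> 0" using rel by blast
    from det[OF this] show "P x" unfolding R by (metis of_bool_eq_0_iff)
  qed
  thus ?thesis unfolding ce_def by blast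
qed

section \<open>A universal machine with finite oracles\<close>

fun rcode :: "rf \<Rightarrow> nat" where
  "rcode Zero = \<langle>0,0\<rangle>"
| "rcode Succ = \<langle>1,0\<rangle>"
| "rcode Fst = \<langle>2,0\<rangle>"
| "rcode Snd = \<langle>3,0\<rangle>"
| "rcode Orc = \<langle>4,0\<rangle>"
| "rcode (Comp f g) = \<langle>5,\<langle>rcode f,rcode g\<rangle>\<rangle>"
| "rcode (Pair f g) = \<langle>6,\<langle>rcode f,rcode g\<rangle>\<rangle>"
| "rcode (Prec f g) = \<langle>7,\<langle>rcode f,rcode g\<rangle>\<rangle>"
| "rcode (Mu f) = \<langle>8,rcode f\<rangle>"

text \<open>A derivation is a finite set of facts \<open>\<langle>r,\<langle>c,\<langle>x,y\<rangle>\<rangle>\<rangle>\<close>, read as ``program \<open>c\<close> maps \<open>x\<close> to \<open>y\<close>'';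
  the rank \<open>r\<close> keeps justifications well-founded.\<close>

definition known :: "nat set \<Rightarrow> nat \<Rightarrow> nat \<Rightarrow> nat \<Rightarrow> nat \<Rightarrow> bool" where
  "known S r c x y \<longleftrightarrow> (\<exists>r'<r. \<langle>r',\<langle>c,\<langle>x,y\<rangle>\<rangle>\<rangle> \<in> S)"

definition justified :: "nat \<Rightarrow> nat set \<Rightarrow> nat \<Rightarrow> nat \<Rightarrow> nat \<Rightarrow> nat \<Rightarrow> bool" where
  "justified s S r c x y \<longleftrightarrow>
     c = \<langle>0,0\<rangle> \<and> y = 0 \<or> c = \<langle>1,0\<rangle> \<and> y = Suc x \<or> c = \<langle>2,0\<rangle> \<and> y = pi1 x \<or> c = \<langle>3,0\<rangle> \<and> y = pi2 x
     \<or> c = \<langle>4,0\<rangle> \<and> x < pi1 s \<and> y = of_bool (x \<in> set_decode (pi2 s))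
     \<or> pi1 c = 5 \<and> (\<exists>m. known S r (pi2 (pi2 c)) x m \<and> known S r (pi1 (pi2 c)) m y)
     \<or> pi1 c = 6 \<and> known S r (pi1 (pi2 c)) x (pi1 y) \<and> known S r (pi2 (pi2 c)) x (pi2 y)
     \<or> pi1 c = 7 \<and> pi2 x = 0 \<and> known S r (pi1 (pi2 c)) (pi1 x) y
     \<or> pi1 c = 7 \<and> pi2 x \<noteq> 0 \<and> (\<exists>z. known S r c \<langle>pi1 x,pi2 x - 1\<rangle> z
          \<and> known S r (pi2 (pi2 c)) \<langle>pi1 x,\<langle>pi2 x - 1,z\<rangle>\<rangle> y)
     \<or> pi1 c = 8 \<and> known S r (pi2 c) \<langle>x,y\<rangle> 0 \<and> (\<forall>m<y. \<exists>z. z \<noteq> 0 \<and> known S r (pi2 c) \<langle>x,m\<rangle> z)"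

definition derivation :: "nat \<Rightarrow> nat set \<Rightarrow> bool" where
  "derivation s S \<longleftrightarrow> (\<forall>r c x y. \<langle>r,\<langle>c,\<langle>x,y\<rangle>\<rangle>\<rangle> \<in> S \<longrightarrow> justified s S r c x y)"

text \<open>The oracle is the string \<open>s = \<langle>n,u\<rangle>\<close> of length \<open>n\<close> with bits \<open>u\<close>; queries beyond \<open>n\<close> diverge.\<close>

definition Ev :: "nat \<Rightarrow> nat \<Rightarrow> nat \<Rightarrow> nat \<Rightarrow> bool" where
  "Ev s c x y \<longleftrightarrow> (\<exists>w. derivation s (set_decode w) \<and> (\<exists>r. \<langle>r,\<langle>c,\<langle>x,y\<rangle>\<rangle>\<rangle> \<in> set_decode w))"

definition pre :: "nat set \<Rightarrow> nat \<Rightarrow> nat" where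
  "pre G n = \<langle>n,set_encode (G \<inter> {..<n})\<rangle>"

lemma set_decode_pre: "set_decode (pi2 (pre G n)) = G \<inter> {..<n}"
  by (simp add: pre_def)

section \<open>Effectivity and soundness of derivations\<close>

lemma dec_known:
  assumes "cpt w" "cpt r" "cpt c" "cpt x" "cpt y"
  shows "dec (\<lambda>z. known (set_decode (w z)) (r z) (c z) (x z) (y z))"
  unfolding known_def by (intro dec_intros cpt_intros cpt_comp[OF assms(1)] cpt_comp[OF assms(2)]
      cpt_comp[OF assms(3)] cpt_comp[OF assms(4)] cpt_comp[OF assms(5)])

lemma set_decode_less: "q \<in> set_decode w \<Longrightarrow> q < w"
proof -
  assume "q \<in> set_decode w"
  hence "2 ^ q \<le> w"
    by (metis div_less even_zero mem_Collect_eq not_le_imp_less set_decode_def)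
  thus "q < w" using less_exp[of q] by linarith
qed

text \<open>Elements of \<open>set_decode w\<close> lie below \<open>w\<close>, so the quantifier
  over all facts becomes bounded, as closure of Sigma-1 under universal quantification
  requires.\<close>

lemma derivation_alt: "derivation s (set_decode w) \<longleftrightarrow> (\<forall>q<w. q \<in> set_decode w \<longrightarrow>
    justified s (set_decode w) (pi1 q) (pi1 (pi2 q)) (pi1 (pi2 (pi2 q))) (pi2 (pi2 (pi2 q))))"
proof
  assume *: "derivation s (set_decode w)"
  have "justified s (set_decode w) (pi1 q) (pi1 (pi2 q)) (pi1 (pi2 (pi2 q))) (pi2 (pi2 (pi2 q)))"
    if "q \<in> set_decode w" for q
    using * that unfolding derivation_def by (metis prod.collapse prod_decode_inverse)
  thus "\<forall>q<w. q \<in> set_decode w \<longrightarrow>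
    justified s (set_decode w) (pi1 q) (pi1 (pi2 q)) (pi1 (pi2 (pi2 q))) (pi2 (pi2 (pi2 q)))" by blast
next
  assume *: "\<forall>q<w. q \<in> set_decode w \<longrightarrow>
    justified s (set_decode w) (pi1 q) (pi1 (pi2 q)) (pi1 (pi2 (pi2 q))) (pi2 (pi2 (pi2 q)))"
  have "justified s (set_decode w) r c x y" if q: "\<langle>r,\<langle>c,\<langle>x,y\<rangle>\<rangle>\<rangle> \<in> set_decode w" for r c x y
    using *[rule_format, OF set_decode_less[OF q] q] by simp
  thus "derivation s (set_decode w)" unfolding derivation_def by blast
qed

lemma sig_Ev0: "sig (\<lambda>z. Ev (pi1 z) (pi1 (pi2 z)) (pi1 (pi2 (pi2 z))) (pi2 (pi2 (pi2 z))))"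
  unfolding Ev_def derivation_alt justified_def
  apply (intro sig_ex sig_conj sig_ball sig_imp sig_disj dec_intros cpt_intros dec_known)
  apply (intro sig_dec dec_intros cpt_intros dec_known)+
  done

lemma sig_Ev:
  assumes "cpt s" "cpt c" "cpt x" "cpt y"
  shows "sig (\<lambda>z. Ev (s z) (c z) (x z) (y z))"
  using sig_subst[OF sig_Ev0, of "\<lambda>z. \<langle>s z,\<langle>c z,\<langle>x z,y z\<rangle>\<rangle>\<rangle>"] assms by (simp add: cpt_pair)

text \<open>Induction on the rank: a justification only cites facts of smaller rank, and the oracle
  string answers its queries as \<open>G\<close> does.\<close>

lemma derivation_sound:
  assumes "derivation (pre G n) S" "\<langle>r,\<langle>rcode p,\<langle>x,y\<rangle>\<rangle>\<rangle> \<in> S"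
  shows "eval (\<lambda>x. x \<in> G) p x y"
  using assms(2)
proof (induction r arbitrary: p x y rule: less_induct)
  case (less r)
  have IH: "eval (\<lambda>x. x \<in> G) p x y" if "known S r (rcode p) x y" for p x y
    using less.IH that unfolding known_def by blast
  have j: "justified (pre G n) S r (rcode p) x y"
    using assms(1) less.prems unfolding derivation_def by blast
  show ?case
  proof (cases p)
    case Zero
    thus ?thesis using j eval.intros(1) by (simp add: justified_def)
  next
    case Succ
    thus ?thesis using j eval.intros(2) by (simp add: justified_def)
  next
    case Fst
    thus ?thesis using j eval.intros(3) by (simp add: justified_def)
  next
    case Snd
    thus ?thesis using j eval.intros(4) by (simp add: justified_def)
  next
    case Orc
    hence "x < n" "y = of_bool (x \<in> G)" using j by (simp_all add: justified_def set_decode_pre pre_def)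
    thus ?thesis using Orc eval.intros(5)[of "\<lambda>x. x \<in> G" x] by (simp add: of_bool_def)
  next
    case (Comp f g)
    then obtain m where "known S r (rcode g) x m" "known S r (rcode f) m y"
      using j by (auto simp: justified_def)
    thus ?thesis using Comp IH eval.intros(6) by blast
  next
    case (Pair f g)
    hence "known S r (rcode f) x (pi1 y)" "known S r (rcode g) x (pi2 y)"
      using j by (auto simp: justified_def)
    hence "eval (\<lambda>x. x \<in> G) (Pair f g) x \<langle>pi1 y,pi2 y\<rangle>" using IH eval.intros(7) by blast
    thus ?thesis using Pair by simp
  next
    case (Prec f g)
    show ?thesis
    proof (cases "pi2 x")
      case 0
      hence "known S r (rcode f) (pi1 x) y" using j Prec by (auto simp: justified_def)
      hence "eval (\<lambda>x. x \<in> G) (Prec f g) \<langle>pi1 x,0\<rangle> y" using IH eval.intros(8) by blast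
      thus ?thesis using Prec 0 by (metis prod.collapse prod_decode_inverse)
    next
      case (Suc k)
      then obtain z where "known S r (rcode (Prec f g)) \<langle>pi1 x,k\<rangle> z" "known S r (rcode g) \<langle>pi1 x,\<langle>k,z\<rangle>\<rangle> y"
        using j Prec by (auto simp: justified_def)
      hence "eval (\<lambda>x. x \<in> G) (Prec f g) \<langle>pi1 x,Suc k\<rangle> y" using IH eval.intros(9) by blast
      thus ?thesis using Prec Suc by (metis prod.collapse prod_decode_inverse)
    qed
  next
    case (Mu f)
    hence "known S r (rcode f) \<langle>x,y\<rangle> 0" "\<forall>m<y. \<exists>z. z \<noteq> 0 \<and> known S r (rcode f) \<langle>x,m\<rangle> z"
      using j by (auto simp: justified_def)
    thus ?thesis using Mu IH eval.intros(10) by metis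
  qed
qed

lemma Ev_sound: "Ev (pre G n) (rcode p) x y \<Longrightarrow> eval (\<lambda>x. x \<in> G) p x y"
  using derivation_sound unfolding Ev_def by blast

section \<open>Completeness of finite derivations\<close>

lemma known_mono: "S \<subseteq> S' \<Longrightarrow> r \<le> r' \<Longrightarrow> known S r c x y \<Longrightarrow> known S' r' c x y"
  unfolding known_def by (meson order_less_le_trans subsetD)

lemma justified_mono: "S \<subseteq> S' \<Longrightarrow> justified s S r c x y \<Longrightarrow> justified s S' r c x y"
  unfolding justified_def using known_mono[OF _ order_refl] by (elim disjE; simp) blast+

text \<open>One finite derivation has to be valid for all sufficiently long prefixes of
  \<open>G\<close>; this lets derivations with different thresholds be united.\<close>

definition derivable :: "nat set \<Rightarrow> rf \<Rightarrow> nat \<Rightarrow> nat \<Rightarrow> bool" where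
  "derivable G p x y \<longleftrightarrow> (\<exists>n0 S. finite S \<and> (\<forall>n\<ge>n0. derivation (pre G n) S) \<and> (\<exists>r. \<langle>r,\<langle>rcode p,\<langle>x,y\<rangle>\<rangle>\<rangle> \<in> S))"

text \<open>Justifications cite facts only positively, so enlarging the set of facts preserves
  them.\<close>

lemma derivation_Un: "derivation s S \<Longrightarrow> derivation s S' \<Longrightarrow> derivation s (S \<union> S')"
  unfolding derivation_def using justified_mono[of S "S \<union> S'"] justified_mono[of S' "S \<union> S'"] by blast

lemma derivable_merge:
  assumes "finite Q" "\<And>p x y. (p, x, y) \<in> Q \<Longrightarrow> derivable G p x y"
  shows "\<exists>n0 S r. finite S \<and> (\<forall>n\<ge>n0. derivation (pre G n) S) \<and> (\<forall>(p, x, y) \<in> Q. known S r (rcode p) x y)"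
  using assms
proof (induction Q rule: finite_induct)
  case empty
  show ?case by (rule exI[of _ 0], rule exI[of _ "{}"]) (simp add: derivation_def)
next
  case (insert q Q)
  obtain p x y where q: "q = (p, x, y)" by (metis prod_cases3)
  obtain n0 S r where 1: "finite S" "\<forall>n\<ge>n0. derivation (pre G n) S" "\<forall>(p, x, y) \<in> Q. known S r (rcode p) x y"
    using insert by (metis insertCI)
  obtain n1 S' r' where 2: "finite S'" "\<forall>n\<ge>n1. derivation (pre G n) S'" "\<langle>r',\<langle>rcode p,\<langle>x,y\<rangle>\<rangle>\<rangle> \<in> S'"
    using insert.prems[of p x y] q unfolding derivable_def by auto
  have "\<forall>n\<ge>max n0 n1. derivation (pre G n) (S \<union> S')" using 1(2) 2(2) derivation_Un by simp
  moreover have "known (S \<union> S') (max r (Suc r')) (rcode p) x y" 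
    unfolding known_def using 2(3) by (intro exI[of _ r']) auto
  moreover have "known (S \<union> S') (max r (Suc r')) (rcode p) x y" if "(p, x, y) \<in> Q" for p x y
    using 1(3) that known_mono[of S "S \<union> S'" r "max r (Suc r')"] by auto
  ultimately show ?case using 1(1) 2(1) q
    by (intro exI[of _ "max n0 n1"] exI[of _ "S \<union> S'"] exI[of _ "max r (Suc r')"]) auto
qed

text \<open>The premises in \<open>Q\<close> share one derivation in which all of them have rank
  below \<open>r\<close>; the conclusion is added at rank \<open>r\<close>. Each rule of
  \<open>eval\<close> is then a single application.\<close>

lemma derivable_step:
  assumes "finite Q" "\<And>p x y. (p, x, y) \<in> Q \<Longrightarrow> derivable G p x y"
    and "\<And>S r n. n1 \<le> n \<Longrightarrow> (\<And>p x y. (p, x, y) \<in> Q \<Longrightarrow> known S r (rcode p) x y)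
           \<Longrightarrow> justified (pre G n) S r (rcode p0) x0 y0"
  shows "derivable G p0 x0 y0"
proof -
  obtain n0 S r where *: "finite S" "\<forall>n\<ge>n0. derivation (pre G n) S" "\<forall>(p, x, y) \<in> Q. known S r (rcode p) x y"
    using derivable_merge[OF assms(1,2)] by blast
  let ?S = "insert \<langle>r,\<langle>rcode p0,\<langle>x0,y0\<rangle>\<rangle>\<rangle> S"
  have "derivation (pre G n) ?S" if "n \<ge> max n0 n1" for n
  proof -
    have "justified (pre G n) S r (rcode p0) x0 y0" using that *(3) by (intro assms(3)) auto
    thus ?thesis using *(2) that unfolding derivation_def
      by (auto intro: justified_mono[OF subset_insertI])
  qed
  thus ?thesis using *(1) unfolding derivable_def
    by (intro exI[of _ "max n0 n1"] exI[of _ ?S]) auto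
qed

lemma eval_derivable: "eval (\<lambda>x. x \<in> G) p x y \<Longrightarrow> derivable G p x y"
proof (induction rule: eval.induct)
  case (1 x)
  show ?case by (rule derivable_step[of "{}"]) (auto simp: justified_def)
next
  case (2 x)
  show ?case by (rule derivable_step[of "{}"]) (auto simp: justified_def)
next
  case (3 x)
  show ?case by (rule derivable_step[of "{}"]) (auto simp: justified_def)
next
  case (4 x)
  show ?case by (rule derivable_step[of "{}"]) (auto simp: justified_def)
next
  case (5 x)
  \<comment> \<open>The query \<open>x\<close> is answered only by strings of length at least
    \<open>Suc x\<close>.\<close>
  show ?case by (rule derivable_step[of "{}" _ "Suc x"]) (auto simp: justified_def set_decode_pre, auto simp: pre_def)
next
  case (6 g x y f z)
  show ?case
  proof (rule derivable_step[of "{(g, x, y), (f, y, z)}"])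
    fix S r n assume "\<And>p x' y'. (p, x', y') \<in> {(g, x, y), (f, y, z)} \<Longrightarrow> known S r (rcode p) x' y'"
    from this[of g x y] this[of f y z] show "justified (pre G n) S r (rcode (Comp f g)) x z"
      by (auto simp: justified_def)
  qed (use 6 in auto)
next
  case (7 f x y g z)
  show ?case
  proof (rule derivable_step[of "{(f, x, y), (g, x, z)}"])
    fix S r n assume "\<And>p x' y'. (p, x', y') \<in> {(f, x, y), (g, x, z)} \<Longrightarrow> known S r (rcode p) x' y'"
    from this[of f x y] this[of g x z] show "justified (pre G n) S r (rcode (Pair f g)) x \<langle>y,z\<rangle>"
      by (simp add: justified_def)
  qed (use 7 in auto)
next
  case (8 f a y g)
  show ?case
  proof (rule derivable_step[of "{(f, a, y)}"])
    fix S r n assume "\<And>p x' y'. (p, x', y') \<in> {(f, a, y)} \<Longrightarrow> known S r (rcode p) x' y'"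
    from this[of f a y] show "justified (pre G n) S r (rcode (Prec f g)) \<langle>a,0\<rangle> y"
      by (simp add: justified_def)
  qed (use 8 in auto)
next
  case (9 f g a n y z)
  show ?case
  proof (rule derivable_step[of "{(Prec f g, \<langle>a,n\<rangle>, y), (g, \<langle>a,\<langle>n,y\<rangle>\<rangle>, z)}"])
    fix S r k assume "\<And>p x' y'. (p, x', y') \<in> {(Prec f g, \<langle>a,n\<rangle>, y), (g, \<langle>a,\<langle>n,y\<rangle>\<rangle>, z)} \<Longrightarrow> known S r (rcode p) x' y'"
    from this[of "Prec f g" "\<langle>a,n\<rangle>" y] this[of g "\<langle>a,\<langle>n,y\<rangle>\<rangle>" z]
    show "justified (pre G k) S r (rcode (Prec f g)) \<langle>a,Suc n\<rangle> z"
      by (auto simp: justified_def)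
  qed (use 9 in auto)
next
  case (10 f a n)
  then obtain h where h: "\<And>m. m < n \<Longrightarrow> h m \<noteq> 0 \<and> derivable G f \<langle>a,m\<rangle> (h m)" by metis
  let ?Q = "insert (f, \<langle>a,n\<rangle>, 0) ((\<lambda>m. (f, \<langle>a,m\<rangle>, h m)) ` {..<n})"
  show ?case
  proof (rule derivable_step[of ?Q])
    fix S r k assume *: "\<And>p x' y'. (p, x', y') \<in> ?Q \<Longrightarrow> known S r (rcode p) x' y'"
    have "known S r (rcode f) \<langle>a,n\<rangle> 0" using * by simp
    moreover have "known S r (rcode f) \<langle>a,m\<rangle> (h m)" if "m < n" for m using * that by simp
    ultimately show "justified (pre G k) S r (rcode (Mu f)) a n"
      using h by (auto simp: justified_def)
  qed (use 10 h in auto)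
qed

lemma Ev_complete: assumes "eval (\<lambda>x. x \<in> G) p x y" obtains n0 where "\<And>n. n \<ge> n0 \<Longrightarrow> Ev (pre G n) (rcode p) x y"
proof -
  obtain n0 S r where *: "finite S" "\<forall>n\<ge>n0. derivation (pre G n) S" "\<langle>r,\<langle>rcode p,\<langle>x,y\<rangle>\<rangle>\<rangle> \<in> S"
    using eval_derivable[OF assms] unfolding derivable_def by blast
  have "Ev (pre G n) (rcode p) x y" if "n \<ge> n0" for n
    unfolding Ev_def using * that by (intro exI[of _ "set_encode S"]) (auto simp: set_encode_inverse)
  thus thesis by (rule that)
qed

text \<open>The string \<open>\<langle>n,0\<rangle>\<close> consists of \<open>n\<close> zeros, so
  this is a run with the empty oracle. Letting \<open>c\<close> vary gives a uniform enumeration of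
  all c.e. sets.\<close>

definition Uni :: "nat \<Rightarrow> nat \<Rightarrow> bool" where
  "Uni c x \<longleftrightarrow> (\<exists>y. \<exists>n. Ev \<langle>n,0\<rangle> c x y)"

lemma sig_Uni: assumes "cpt c" "cpt x" shows "sig (\<lambda>z. Uni (c z) (x z))"
  unfolding Uni_def by (intro sig_ex sig_Ev cpt_intros cpt_comp[OF assms(1)] cpt_comp[OF assms(2)])

lemma ce_Uni: "ce V \<Longrightarrow> \<exists>c. \<forall>x. x \<in> V \<longleftrightarrow> Uni c x"
proof -
  assume "ce V"
  then obtain p where p: "\<And>x. x \<in> V \<longleftrightarrow> (\<exists>y. eval (\<lambda>_. False) p x y)" unfolding ce_def by blast
  have pre: "pre {} n = \<langle>n,0\<rangle>" for n by (simp add: pre_def)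
  have "x \<in> V \<longleftrightarrow> Uni (rcode p) x" for x
  proof
    assume "x \<in> V"
    then obtain y where "eval (\<lambda>x. x \<in> {}) p x y" using p by auto
    then obtain n where "Ev (pre {} n) (rcode p) x y" using Ev_complete by blast
    thus "Uni (rcode p) x" unfolding Uni_def pre by blast
  next
    assume "Uni (rcode p) x"
    then obtain y n where "Ev (pre {} n) (rcode p) x y" unfolding Uni_def pre by blast
    from Ev_sound[OF this] show "x \<in> V" using p by auto
  qed
  thus ?thesis by blast
qed

lemma ce_sig: assumes "ce V" "cpt f" shows "sig (\<lambda>x. f x \<in> V)"
proof -
  obtain c where "\<And>x. x \<in> V \<longleftrightarrow> Uni c x" using ce_Uni[OF assms(1)] by blast
  thus ?thesis using sig_Uni[OF cpt_const assms(2), of c] by simp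
qed

section \<open>Weights, balls and large sets of outputs\<close>

text \<open>Weight is packaged as a measure on codes, which provides subadditivity and continuity
  from above and below.\<close>

definition wmeas :: "nat measure" where
  "wmeas = density (count_space UNIV) (\<lambda>x. ennreal ((1/2) ^ pi1 x))"

definition weight :: "nat set \<Rightarrow> ennreal" where "weight S = emeasure wmeas S"

lemma sets_wmeas [simp]: "sets wmeas = UNIV"
  by (simp add: wmeas_def)

lemma weight_mono: "S \<subseteq> S' \<Longrightarrow> weight S \<le> weight S'"
  unfolding weight_def by (rule emeasure_mono) auto

lemma weight_Un_le: "weight (S \<union> S') \<le> weight S + weight S'"
  unfolding weight_def by (rule emeasure_subadditive) auto

lemma weight_empty [simp]: "weight {} = 0"
  by (simp add: weight_def)

lemma weight_le_Un: "S \<subseteq> A \<union> B \<Longrightarrow> weight A \<le> a \<Longrightarrow> weight B \<le> b \<Longrightarrow> weight S \<le> a + b"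
  by (meson weight_Un_le weight_mono add_mono order_trans)

lemma weight_split: "weight S = weight (S \<inter> A) + weight (S - A)"
  unfolding weight_def using plus_emeasure[of "S \<inter> A" wmeas "S - A"]
  by (simp add: Int_Diff_Un Int_Diff_disjoint)

lemma weight_finite: "finite S \<Longrightarrow> weight S = (\<Sum>x\<in>S. ennreal ((1/2) ^ pi1 x))"
  unfolding weight_def wmeas_def
  by (subst emeasure_density) (auto simp: nn_integral_count_space_indicator[symmetric] nn_integral_count_space_finite)

lemma weight_finite_less_top: "finite S \<Longrightarrow> weight S < \<infinity>"
  by (simp add: weight_finite)

lemma weight_tail: assumes "weight K < \<infinity>" "0 < \<eta>" obtains n where "weight (K - {..<n}) \<le> \<eta>"
proof -
  have "weight (K - {..<n}) < \<infinity>" for n using weight_mono[of "K - {..<n}" K] assms(1) by (simp add: order.strict_trans1)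
  hence "(\<lambda>n. emeasure wmeas (K - {..<n})) \<longlonglongrightarrow> emeasure wmeas (\<Inter>n. K - {..<n})"
    by (intro Lim_emeasure_decseq) (auto simp: decseq_def weight_def top.not_eq_extremum)
  also have "(\<Inter>n. K - {..<n}) = {}" by auto
  finally have "(\<lambda>n. weight (K - {..<n})) \<longlonglongrightarrow> 0" by (simp add: weight_def)
  hence "\<forall>\<^sub>F n in sequentially. weight (K - {..<n}) < \<eta>" using assms(2) by (rule order_tendstoD)
  then obtain n where "weight (K - {..<n}) < \<eta>" using eventually_happens trivial_limit_sequentially by blast
  thus thesis using that less_imp_le by blast
qed

lemma weight_tail_ge: assumes "weight K < \<infinity>" "0 < \<eta>" obtains n where "n \<ge> m" "weight (K - {..<n}) \<le> \<eta>"
proof -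
  obtain n where "weight (K - {..<n}) \<le> \<eta>" using weight_tail[OF assms] .
  moreover have "weight (K - {..<max m n}) \<le> weight (K - {..<n})" by (rule weight_mono) auto
  ultimately show thesis using that[of "max m n"] by simp
qed

text \<open>Continuity from below. In effect, an upper bound on the weight is a closed condition on
  \<open>K\<close>.\<close>

lemma weight_le_prefix: assumes "\<And>n. weight (K \<inter> {..<n}) \<le> \<beta>" shows "weight K \<le> \<beta>"
proof -
  have "(\<lambda>n. emeasure wmeas (K \<inter> {..<n})) \<longlonglongrightarrow> emeasure wmeas (\<Union>n. K \<inter> {..<n})"
    by (intro Lim_emeasure_incseq) (auto simp: incseq_def)
  also have "(\<Union>n. K \<inter> {..<n}) = K" by auto
  finally show ?thesis using assms unfolding weight_def by (intro LIMSEQ_le_const2) auto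
qed

section \<open>Balls and closed classes\<close>

definition wball :: "nat set \<Rightarrow> ennreal \<Rightarrow> nat \<Rightarrow> nat set set" where
  "wball K \<eta> N = {G. K \<subseteq> G \<and> G \<inter> {..<N} = K \<inter> {..<N} \<and> weight (G - K) \<le> \<eta>}"

text \<open>Closed classes are given by their forbidden prefixes; for c.e. \<open>V\<close> these
  are the Pi-0-1 classes.\<close>

definition avoid :: "nat set \<Rightarrow> nat set set" where
  "avoid V = {G. \<forall>n. pre G n \<notin> V}"

definition fat :: "nat set \<Rightarrow> bool" where
  "fat V \<longleftrightarrow> (\<exists>K \<eta> N. weight K < \<infinity> \<and> 0 < \<eta> \<and> wball K \<eta> N \<subseteq> avoid V)"

lemma wball_self: "K \<in> wball K \<eta> N"
  by (simp add: wball_def)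

lemma wball_mono: "\<eta> \<le> \<eta>' \<Longrightarrow> wball K \<eta> N \<subseteq> wball K \<eta>' N"
  by (auto simp: wball_def)

text \<open>Triangle inequality: the errors \<open>e\<close> and \<open>\<eta>\<close> add up, and
  agreement on a longer prefix only shrinks a ball.\<close>

lemma wball_subset:
  assumes "E \<in> wball K e N" "N \<le> n" "e + \<eta> \<le> \<epsilon>"
  shows "wball E \<eta> n \<subseteq> wball K \<epsilon> N"
proof
  fix G assume G: "G \<in> wball E \<eta> n"
  have "G \<inter> {..<N} = (G \<inter> {..<n}) \<inter> {..<N}" using assms(2) by auto
  also have "\<dots> = E \<inter> {..<N}" using G assms(2) by (auto simp: wball_def)
  also have "\<dots> = K \<inter> {..<N}" using assms(1) by (auto simp: wball_def)
  finally have 1: "G \<inter> {..<N} = K \<inter> {..<N}" .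
  have "weight (G - K) \<le> e + \<eta>"
    by (rule weight_le_Un[of _ "E - K" "G - E"]) (use G assms(1) in \<open>auto simp: wball_def\<close>)
  thus "G \<in> wball K \<epsilon> N" using G assms 1 by (auto simp: wball_def)
qed

section \<open>Prefixes and compactness of Cantor space\<close>

lemma pre_eq_iff: "pre G n = pre G' m \<longleftrightarrow> n = m \<and> G \<inter> {..<n} = G' \<inter> {..<n}"
  unfolding pre_def by (auto simp: set_encode_eq)

lemma Int_lessThan_mono: "G \<inter> {..<m} = G' \<inter> {..<m} \<Longrightarrow> n \<le> (m::nat) \<Longrightarrow> G \<inter> {..<n} = G' \<inter> {..<n}"
proof -
  assume "G \<inter> {..<m} = G' \<inter> {..<m}" "n \<le> m"
  moreover have "A \<inter> {..<n} = (A \<inter> {..<m}) \<inter> {..<n}" for A using \<open>n \<le> m\<close> by auto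
  ultimately show ?thesis by metis
qed

text \<open>A prefix of length \<open>n\<close> is kept if it extends to solutions of
  \<open>T m\<close> for all \<open>m \<ge> n\<close>. One of its two one-bit extensions inherits
  this: if they failed at levels \<open>m0\<close> and \<open>m1\<close>, a solution at the maximum
  of both levels would give a contradiction by \<open>down\<close>.\<close>

lemma weak_koenig:
  fixes T :: "nat \<Rightarrow> nat set \<Rightarrow> bool"
  assumes ex: "\<And>n. \<exists>K. T n K"
    and local: "\<And>n K K'. K \<inter> {..<n} = K' \<inter> {..<n} \<Longrightarrow> T n K \<Longrightarrow> T n K'"
    and down: "\<And>m n K. n \<le> m \<Longrightarrow> T m K \<Longrightarrow> T n K"
  shows "\<exists>K. \<forall>n. T n K"
proof -
  define Ext where "Ext n A \<longleftrightarrow> (\<forall>m\<ge>n. \<exists>K. K \<inter> {..<n} = A \<inter> {..<n} \<and> T m K)" for n A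
  have "\<exists>A. \<forall>n. Ext n (A n) \<and> A (Suc n) \<inter> {..<n} = A n \<inter> {..<n}"
  proof (rule dependent_nat_choice)
    show "\<exists>A. Ext 0 A" using ex by (simp add: Ext_def)
  next
    fix A n assume A: "Ext n A"
    define B0 B1 where "B0 = A \<inter> {..<n}" and "B1 = insert n (A \<inter> {..<n})"
    have "Ext (Suc n) B0 \<or> Ext (Suc n) B1"
    proof (rule ccontr)
      assume "\<not> ?thesis"
      hence n0: "\<not> Ext (Suc n) B0" and n1: "\<not> Ext (Suc n) B1" by auto
      obtain m0 where m0: "m0 \<ge> Suc n" "\<forall>K. K \<inter> {..<Suc n} = B0 \<inter> {..<Suc n} \<longrightarrow> \<not> T m0 K"
        using n0 unfolding Ext_def not_all not_imp not_ex de_Morgan_conj by blast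
      obtain m1 where m1: "m1 \<ge> Suc n" "\<forall>K. K \<inter> {..<Suc n} = B1 \<inter> {..<Suc n} \<longrightarrow> \<not> T m1 K"
        using n1 unfolding Ext_def not_all not_imp not_ex de_Morgan_conj by blast
      have "n \<le> max m0 m1" using m0(1) by simp
      obtain K where K: "K \<inter> {..<n} = A \<inter> {..<n}" "T (max m0 m1) K"
        using A[unfolded Ext_def, rule_format, OF \<open>n \<le> max m0 m1\<close>] by (elim exE conjE)
      hence "T m0 K" "T m1 K" using down by (meson max.cobounded1 max.cobounded2)+
      moreover have "K \<inter> {..<Suc n} = B0 \<inter> {..<Suc n} \<or> K \<inter> {..<Suc n} = B1 \<inter> {..<Suc n}"
        using K(1) by (cases "n \<in> K") (auto simp: B0_def B1_def lessThan_Suc)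
      ultimately show False using m0(2) m1(2) by auto
    qed
    moreover have "B0 \<inter> {..<n} = A \<inter> {..<n}" "B1 \<inter> {..<n} = A \<inter> {..<n}" by (auto simp: B0_def B1_def)
    ultimately show "\<exists>B. Ext (Suc n) B \<and> B \<inter> {..<n} = A \<inter> {..<n}" by blast
  qed
  then obtain A where A: "\<And>n. Ext n (A n)" "\<And>n. A (Suc n) \<inter> {..<n} = A n \<inter> {..<n}" by blast
  have coh: "A (n + k) \<inter> {..<n} = A n \<inter> {..<n}" for n k
  proof (induction k)
    case (Suc k)
    have "A (n + Suc k) \<inter> {..<n} = A (n + k) \<inter> {..<n}"
      using Int_lessThan_mono[OF A(2)[of "n + k"], of n] by simp
    thus ?case using Suc by simp
  qed simp
  \<comment> \<open>Bit \<open>n\<close> is settled from stage \<open>Suc n\<close> on, so it is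
    read off there.\<close>
  define K where "K = {n. n \<in> A (Suc n)}"
  have "K \<inter> {..<n} = A n \<inter> {..<n}" for n
  proof (intro set_eqI iffI)
    fix x assume "x \<in> K \<inter> {..<n}"
    thus "x \<in> A n \<inter> {..<n}" using coh[of "Suc x" "n - Suc x"] by (auto simp: K_def)
  next
    fix x assume "x \<in> A n \<inter> {..<n}"
    thus "x \<in> K \<inter> {..<n}" using coh[of "Suc x" "n - Suc x"] by (auto simp: K_def)
  qed
  note KA = this
  have "T n K" for n
  proof -
    obtain K' where "K' \<inter> {..<n} = A n \<inter> {..<n}" "T n K'"
      using A(1)[of n, unfolded Ext_def, rule_format, OF order_refl] by (elim exE conjE)
    thus ?thesis using KA[of n] local[of K' n K] by simp
  qed
  thus ?thesis by (intro exI allI)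
qed

text \<open>The shift graph has no finite colouring: \<open>j \<mapsto> {f i j | i < j}\<close> would be injective.\<close>
lemma shift_monochromatic:
  fixes f :: "nat \<Rightarrow> nat \<Rightarrow> 'a"
  assumes "finite C" "\<And>i j. l \<le> i \<Longrightarrow> i < j \<Longrightarrow> f i j \<in> C"
  shows "\<exists>i j k. l \<le> i \<and> i < j \<and> j < k \<and> f i j = f j k"
proof (rule ccontr)
  assume no: "\<not> ?thesis"
  define S where "S j = {f i j | i. l \<le> i \<and> i < j}" for j
  have ne: "S j \<noteq> S k" if "l \<le> j" "j < k" for j k
  proof -
    have "f j k \<in> S k" using that by (auto simp: S_def)
    moreover have "f j k \<notin> S j"
    proof
      assume "f j k \<in> S j"
      then obtain i where "l \<le> i" "i < j" "f j k = f i j" unfolding S_def by auto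
      thus False using no that by metis
    qed
    ultimately show ?thesis by auto
  qed
  have "inj_on S {l..}" by (rule inj_onI) (metis atLeast_iff ne nat_neq_iff)
  moreover have "S ` {l..} \<subseteq> Pow C" using assms(2) by (auto simp: S_def)
  ultimately have "finite {l..}" using assms(1) by (meson finite_Pow_iff finite_imageD finite_subset)
  thus False using infinite_Ici by blast
qed

text \<open>For fixed \<open>n\<close> the prefixes \<open>F i j \<inter> {..<n}\<close> colour the
  pairs with finitely many colours, so two consecutive pairs share a prefix. Compactness chooses
  these prefixes coherently in \<open>n\<close>.\<close>

lemma shift_limit:
  fixes F :: "nat \<Rightarrow> nat \<Rightarrow> nat set"
  shows "\<exists>K. \<forall>n. \<exists>i j k. l \<le> i \<and> i < j \<and> j < k \<and> F i j \<inter> {..<n} = K \<inter> {..<n} \<and> F j k \<inter> {..<n} = K \<inter> {..<n}"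
proof (rule weak_koenig)
  fix n
  obtain i j k where "l \<le> i" "i < j" "j < k" "F i j \<inter> {..<n} = F j k \<inter> {..<n}"
    using shift_monochromatic[of "Pow {..<n}" l "\<lambda>i j. F i j \<inter> {..<n}"] by auto
  thus "\<exists>K i j k. l \<le> i \<and> i < j \<and> j < k \<and> F i j \<inter> {..<n} = K \<inter> {..<n} \<and> F j k \<inter> {..<n} = K \<inter> {..<n}"
    by blast
next
  fix m n K assume "n \<le> m" "\<exists>i j k. l \<le> i \<and> i < j \<and> j < k \<and> F i j \<inter> {..<m} = K \<inter> {..<m} \<and> F j k \<inter> {..<m} = K \<inter> {..<m}"
  thus "\<exists>i j k. l \<le> i \<and> i < j \<and> j < k \<and> F i j \<inter> {..<n} = K \<inter> {..<n} \<and> F j k \<inter> {..<n} = K \<inter> {..<n}"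
    using Int_lessThan_mono by metis
qed simp

section \<open>Steering the output of a functional\<close>

definition out :: "rf \<Rightarrow> nat set \<Rightarrow> nat \<Rightarrow> nat set \<Rightarrow> bool" where
  "out p G l \<tau> \<longleftrightarrow> (\<forall>x<l. eval (\<lambda>x. x \<in> G) p x (of_bool (x \<in> \<tau>)))"

definition out_at :: "nat \<Rightarrow> nat \<Rightarrow> nat \<Rightarrow> nat set \<Rightarrow> bool" where
  "out_at s c l \<tau> \<longleftrightarrow> (\<forall>x<l. Ev s c x (of_bool (x \<in> \<tau>)))"

lemma out_at_sound: "out_at (pre G n) (rcode p) l \<tau> \<Longrightarrow> out p G l \<tau>"
  unfolding out_at_def out_def using Ev_sound by blast

lemma Ev_complete_bounded:
  assumes "\<And>x. x < m \<Longrightarrow> eval (\<lambda>x. x \<in> G) p x (h x)"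
  obtains n0 where "\<And>n x. n \<ge> n0 \<Longrightarrow> x < m \<Longrightarrow> Ev (pre G n) (rcode p) x (h x)"
proof -
  have "\<exists>n0. \<forall>n\<ge>n0. \<forall>x<m. Ev (pre G n) (rcode p) x (h x)" using assms
  proof (induction m)
    case (Suc m)
    obtain n0 where "\<forall>n\<ge>n0. \<forall>x<m. Ev (pre G n) (rcode p) x (h x)" using Suc by force
    moreover obtain n1 where "\<And>n. n \<ge> n1 \<Longrightarrow> Ev (pre G n) (rcode p) m (h m)"
      using Ev_complete[OF Suc.prems[of m]] by auto
    ultimately have "\<forall>n\<ge>max n0 n1. \<forall>x<Suc m. Ev (pre G n) (rcode p) x (h x)"
      by (simp add: less_Suc_eq)
    thus ?case by blast
  qed simp
  thus thesis using that by blast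
qed

lemma out_complete: assumes "out p G l \<tau>" obtains n0 where "\<And>n. n \<ge> n0 \<Longrightarrow> out_at (pre G n) (rcode p) l \<tau>"
  using Ev_complete_bounded[of l G p "\<lambda>x. of_bool (x \<in> \<tau>)"] assms unfolding out_def out_at_def by metis

text \<open>With prefix, radius and weight bound fixed in advance, the cores form a closed set, so
  limits of cores are available.\<close>

definition cores :: "nat set \<Rightarrow> nat set \<Rightarrow> nat \<Rightarrow> ennreal \<Rightarrow> ennreal \<Rightarrow> nat set set" where
  "cores V \<sigma> N \<epsilon> \<beta> = {K. K \<inter> {..<N} = \<sigma> \<and> weight K \<le> \<beta> \<and> wball K \<epsilon> N \<subseteq> avoid V}"

text \<open>After the tail of \<open>G\<close> is replaced by that of \<open>K'\<close>, the
  difference from \<open>K'\<close> lies below \<open>n\<close>, where \<open>K'\<close> agrees with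
  \<open>K\<close>; hence its weight does not grow.\<close>

lemma graft_wball:
  assumes "G \<in> wball K e N" "K' \<inter> {..<n} = K \<inter> {..<n}" "N \<le> n"
  shows "G \<inter> {..<n} \<union> (K' - {..<n}) \<in> wball K' e N"
proof -
  have "weight (G \<inter> {..<n} \<union> (K' - {..<n}) - K') \<le> weight (G - K)"
    by (rule weight_mono) (use assms(2) in auto)
  moreover have "K' \<subseteq> G \<inter> {..<n} \<union> (K' - {..<n})" using assms(1,2) by (auto simp: wball_def)
  moreover have "(G \<inter> {..<n} \<union> (K' - {..<n})) \<inter> {..<N} = K' \<inter> {..<N}"
  proof -
    have "(G \<inter> {..<n} \<union> (K' - {..<n})) \<inter> {..<N} = G \<inter> {..<N}" using assms(3) by auto
    also have "\<dots> = K \<inter> {..<N}" using assms(1) by (simp add: wball_def)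
    also have "\<dots> = K' \<inter> {..<N}" using Int_lessThan_mono[OF assms(2,3)] by simp
    finally show ?thesis .
  qed
  ultimately show ?thesis using assms(1) by (auto simp: wball_def)
qed

text \<open>If a member of the ball around the limit had a forbidden prefix, then grafting the tail
  of a core that agrees with the limit far enough would give a member of that core's ball with the
  same forbidden prefix.\<close>

lemma cores_closed:
  assumes "\<And>n. \<exists>K'\<in>cores V \<sigma> N \<epsilon> \<beta>. K' \<inter> {..<n} = K \<inter> {..<n}"
  shows "K \<in> cores V \<sigma> N \<epsilon> \<beta>"
proof -
  have "K \<inter> {..<N} = \<sigma>" using assms[of N] by (auto simp: cores_def)
  moreover have "weight K \<le> \<beta>"
  proof (rule weight_le_prefix)
    fix n
    obtain K' where "K' \<in> cores V \<sigma> N \<epsilon> \<beta>" "K' \<inter> {..<n} = K \<inter> {..<n}" using assms by blast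
    thus "weight (K \<inter> {..<n}) \<le> \<beta>" using weight_mono[of "K' \<inter> {..<n}" K'] unfolding cores_def by fastforce
  qed
  moreover have "G \<in> avoid V" if G: "G \<in> wball K \<epsilon> N" for G
    unfolding avoid_def
  proof safe
    fix n assume bad: "pre G n \<in> V"
    obtain K' where K': "K' \<in> cores V \<sigma> N \<epsilon> \<beta>" "K' \<inter> {..<max n N} = K \<inter> {..<max n N}" using assms by blast
    let ?G = "G \<inter> {..<max n N} \<union> (K' - {..<max n N})"
    have "?G \<in> wball K' \<epsilon> N" using graft_wball[OF G K'(2)] by simp
    hence "pre ?G n \<notin> V" using K'(1) by (auto simp: cores_def avoid_def)
    moreover have "pre ?G n = pre G n" unfolding pre_eq_iff by auto
    ultimately show False using bad by simp
  qed
  ultimately show ?thesis by (auto simp: cores_def)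
qed

definition large :: "rf \<Rightarrow> nat set set \<Rightarrow> nat \<Rightarrow> ennreal \<Rightarrow> nat \<Rightarrow> nat set set \<Rightarrow> bool" where
  "large p \<H> N e l T \<longleftrightarrow> (\<forall>K\<in>\<H>. \<exists>G\<in>wball K e N. \<exists>\<tau>\<in>T. out p G l \<tau>)"

definition constrain :: "nat \<Rightarrow> nat set set \<Rightarrow> nat \<Rightarrow> nat \<Rightarrow> nat set set" where
  "constrain l T i j = {\<tau>. \<tau> \<subseteq> {..<Suc j} \<and> \<tau> \<inter> {..<l} \<in> T \<and> \<not> (i \<in> \<tau> \<and> j \<notin> \<tau>)}"

text \<open>The case in which divergence cannot be forced inside the class. A value above 1 counts
  as divergence, since only 0-1 sequences matter.\<close>

definition nondivergent :: "rf \<Rightarrow> nat set \<Rightarrow> bool" where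
  "nondivergent p V \<longleftrightarrow> (\<forall>E \<eta> N m. weight E < \<infinity> \<longrightarrow> 0 < \<eta> \<longrightarrow> wball E \<eta> N \<subseteq> avoid V \<longrightarrow>
     (\<exists>G\<in>wball E \<eta> N. \<forall>x<m. \<exists>y\<le>1. eval (\<lambda>x. x \<in> G) p x y))"

text \<open>The expense \<open>3 * \<delta>\<close> splits into \<open>2 * \<delta>\<close> for
  adjoining the tail of a second core that shares a long prefix, and \<open>\<delta>\<close> for the
  ball in which the functional is made to converge.\<close>

lemma large_step:
  assumes nd: "nondivergent p V"
    and lower: "\<And>K. K \<in> cores V \<sigma> N \<epsilon> \<beta> \<Longrightarrow> \<gamma> \<le> weight K"
    and \<beta>: "\<beta> \<le> \<gamma> + \<delta>" "\<beta> < \<infinity>" and \<delta>: "0 < \<delta>" "\<delta> < \<infinity>"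
    and lg: "large p (cores V \<sigma> N \<epsilon> \<beta>) N e l T" and T: "T \<subseteq> Pow {..<l}"
    and e: "e + 3 * \<delta> \<le> \<epsilon>"
  shows "\<exists>i j. l \<le> i \<and> i < j \<and> large p (cores V \<sigma> N \<epsilon> \<beta>) N (e + 3 * \<delta>) (Suc j) (constrain l T i j)"
proof (rule ccontr)
  let ?H = "cores V \<sigma> N \<epsilon> \<beta>"
  assume "\<not> ?thesis"
  hence "\<forall>i j. \<exists>K. l \<le> i \<and> i < j \<longrightarrow> K \<in> ?H \<and>
      (\<forall>G\<in>wball K (e + 3 * \<delta>) N. \<forall>\<tau>\<in>constrain l T i j. \<not> out p G (Suc j) \<tau>)"
    unfolding large_def by metis
  \<comment> \<open>\<open>F i j\<close> is a core above which no output satisfies the constraint at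
    \<open>i\<close>, \<open>j\<close>.\<close>
  then obtain F where F: "\<And>i j. l \<le> i \<Longrightarrow> i < j \<Longrightarrow> F i j \<in> ?H"
    "\<And>i j G \<tau>. l \<le> i \<Longrightarrow> i < j \<Longrightarrow> G \<in> wball (F i j) (e + 3 * \<delta>) N \<Longrightarrow> \<tau> \<in> constrain l T i j \<Longrightarrow> \<not> out p G (Suc j) \<tau>"
    by metis
  obtain K where K: "\<And>n. \<exists>i j k. l \<le> i \<and> i < j \<and> j < k \<and> F i j \<inter> {..<n} = K \<inter> {..<n} \<and> F j k \<inter> {..<n} = K \<inter> {..<n}"
    using shift_limit[of l F] by blast
  \<comment> \<open>As a limit of cores, \<open>K\<close> is a core, so the output above it can
    already be steered into \<open>T\<close>; only a finite prefix of the witness \<open>G\<close>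
    matters for this.\<close>
  have KH: "K \<in> ?H" by (rule cores_closed) (use K F(1) in meson)
  then obtain G \<tau> where G: "G \<in> wball K e N" "\<tau> \<in> T" "out p G l \<tau>" using lg unfolding large_def by blast
  obtain n0 where n0: "\<And>n. n \<ge> n0 \<Longrightarrow> out_at (pre G n) (rcode p) l \<tau>" using out_complete[OF G(3)] by blast
  have "weight K < \<infinity>" using KH \<beta>(2) by (auto simp: cores_def order.strict_trans1)
  then obtain n where n: "n \<ge> max n0 N" "weight (K - {..<n}) \<le> \<delta>" using weight_tail_ge \<delta>(1) by blast
  have fin: "weight (K \<inter> {..<n}) \<noteq> \<infinity>" using weight_finite_less_top[of "K \<inter> {..<n}"] by simp
  have "\<gamma> \<le> weight (K \<inter> {..<n}) + weight (K - {..<n})" using lower[OF KH] weight_split[of K] by metis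
  also have "\<dots> \<le> weight (K \<inter> {..<n}) + \<delta>" using n(2) by (intro add_left_mono)
  finally have \<gamma>: "\<gamma> \<le> weight (K \<inter> {..<n}) + \<delta>" .
  \<comment> \<open>By \<open>lower\<close> the weight of \<open>K\<close> is at least
    \<open>\<gamma>\<close>, and at most \<open>\<delta>\<close> of it lies beyond \<open>n\<close>.
    A core with the same prefix has weight at most \<open>\<gamma> + \<delta>\<close>
    altogether.\<close>
  have tail: "weight (K' - {..<n}) \<le> 2 * \<delta>" if "K' \<in> ?H" "K' \<inter> {..<n} = K \<inter> {..<n}" for K'
  proof -
    have "weight (K \<inter> {..<n}) + weight (K' - {..<n}) = weight K'" using weight_split[of K' "{..<n}"] that(2) by simp
    also have "\<dots> \<le> \<gamma> + \<delta>" using that(1) \<beta>(1) by (auto simp: cores_def)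
    also have "\<dots> \<le> weight (K \<inter> {..<n}) + \<delta> + \<delta>" by (intro add_right_mono \<gamma>)
    also have "\<dots> = weight (K \<inter> {..<n}) + 2 * \<delta>" by (simp add: add.assoc mult_2)
    finally show ?thesis using fin by (simp add: ennreal_add_left_cancel_le)
  qed
  obtain i j k where ijk: "l \<le> i" "i < j" "j < k" "F i j \<inter> {..<n} = K \<inter> {..<n}" "F j k \<inter> {..<n} = K \<inter> {..<n}"
    using K by blast
  \<comment> \<open>Prefix of \<open>G\<close> and the tails of both blocking cores: the set lies
    above both at once. Its construction is symmetric in the two cores, so one estimate serves for
    both.\<close>
  define E where "E = G \<inter> {..<n} \<union> (F i j - {..<n}) \<union> (F j k - {..<n})"
  have Ein: "E \<in> wball A (e + 2 * \<delta>) N"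
    if A: "A \<inter> {..<n} = K \<inter> {..<n}" and B: "B \<in> ?H" "B \<inter> {..<n} = K \<inter> {..<n}"
      and E: "E = G \<inter> {..<n} \<union> (A - {..<n}) \<union> (B - {..<n})" for A B
  proof -
    have g: "G \<inter> {..<n} \<union> (A - {..<n}) \<in> wball A e N" by (rule graft_wball[OF G(1) A]) (use n in simp)
    have "weight (E - A) \<le> e + 2 * \<delta>"
      by (rule weight_le_Un[of _ "G \<inter> {..<n} \<union> (A - {..<n}) - A" "B - {..<n}"])
        (use g tail[OF B] E in \<open>auto simp: wball_def\<close>)
    moreover have "A \<subseteq> E" using g E by (auto simp: wball_def)
    moreover have "E \<inter> {..<N} = A \<inter> {..<N}"
    proof -
      have "E \<inter> {..<N} = (G \<inter> {..<n} \<union> (A - {..<n})) \<inter> {..<N}" using E n by auto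
      thus ?thesis using g by (simp add: wball_def)
    qed
    ultimately show ?thesis by (simp add: wball_def)
  qed
  have E1: "E \<in> wball (F i j) (e + 2 * \<delta>) N"
    by (rule Ein[of _ "F j k"]) (use ijk F(1) in \<open>auto simp: E_def\<close>)
  have E2: "E \<in> wball (F j k) (e + 2 * \<delta>) N"
    by (rule Ein[of _ "F i j"]) (use ijk F(1) in \<open>auto simp: E_def\<close>)
  have d3: "e + 2 * \<delta> + \<delta> \<le> e + 3 * \<delta>"
    using distrib_right[of 2 1 \<delta>] by (simp add: add.assoc)
  have sub1: "wball E \<delta> n \<subseteq> wball (F i j) (e + 3 * \<delta>) N" using wball_subset[OF E1 _ d3] n by simp
  have sub2: "wball E \<delta> n \<subseteq> wball (F j k) (e + 3 * \<delta>) N" using wball_subset[OF E2 _ d3] n by simp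
  have "wball E \<delta> n \<subseteq> avoid V"
    using sub1 wball_mono[OF e, of "F i j" N] F(1)[OF ijk(1,2)] by (auto simp: cores_def)
  moreover have "weight E < \<infinity>"
  proof -
    have "weight E \<le> weight (G \<inter> {..<n}) + 2 * \<delta> + 2 * \<delta>"
      unfolding E_def using ijk F(1)
      by (intro weight_le_Un[OF order_refl] tail order_refl) auto
    also have "\<dots> < \<infinity>" using weight_finite_less_top[of "G \<inter> {..<n}"] \<delta>(2)
      by (simp add: ennreal_mult_less_top)
    finally show ?thesis .
  qed
  ultimately obtain G' where G': "G' \<in> wball E \<delta> n" "\<And>x. x < Suc k \<Longrightarrow> \<exists>y\<le>1. eval (\<lambda>x. x \<in> G') p x y"
    using nd \<delta>(1) unfolding nondivergent_def by meson
  have "pre G' n = pre G n" unfolding pre_eq_iff using G'(1) by (auto simp: wball_def E_def)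
  hence outl: "out p G' l \<tau>" using n0[of n] n(1) out_at_sound by (metis max.boundedE)
  \<comment> \<open>The output of \<open>G'\<close>, relevant up to \<open>k\<close> only: it is
    \<open>\<tau>\<close> below \<open>l\<close> because \<open>G'\<close> and \<open>G\<close>
    share the prefix of length \<open>n\<close>.\<close>
  define X where "X = \<tau> \<union> {x. l \<le> x \<and> eval (\<lambda>x. x \<in> G') p x 1}"
  have Xl: "X \<inter> {..<l} = \<tau>" using T G(2) by (auto simp: X_def)
  have X: "eval (\<lambda>x. x \<in> G') p x (of_bool (x \<in> X))" if xk: "x < Suc k" for x
  proof (cases "x < l")
    case True
    moreover have "x \<in> X \<longleftrightarrow> x \<in> \<tau>" using True Xl by auto
    ultimately show ?thesis using outl by (simp add: out_def)
  next
    case False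
    obtain y where y: "y \<le> 1" "eval (\<lambda>x. x \<in> G') p x y" using G'(2)[OF xk] by (elim exE conjE)
    have "x \<notin> \<tau>" using False T G(2) by auto
    hence "x \<in> X \<longleftrightarrow> eval (\<lambda>x. x \<in> G') p x 1" using False by (simp add: X_def)
    also have "\<dots> \<longleftrightarrow> y = 1" using y(2) eval_det[OF y(2), of 1] by auto
    finally have "of_bool (x \<in> X) = y" using y(1) by auto
    thus ?thesis using y(2) by simp
  qed
  have bad: "a \<in> X \<and> b \<notin> X" if "l \<le> a" "a < b" "b \<le> k" "G' \<in> wball (F a b) (e + 3 * \<delta>) N" for a b
  proof (rule ccontr)
    assume c: "\<not> ?thesis"
    have "X \<inter> {..<Suc b} \<in> constrain l T a b"
    proof -
      have "X \<inter> {..<Suc b} \<inter> {..<l} = \<tau>" using Xl that by auto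
      thus ?thesis using G(2) c that by (auto simp: constrain_def)
    qed
    moreover have "out p G' (Suc b) (X \<inter> {..<Suc b})" using X that by (auto simp: out_def)
    ultimately show False using F(2)[OF that(1,2,4)] by blast
  qed
  \<comment> \<open>The pair \<open>i\<close>, \<open>j\<close> gives \<open>j \<notin> X\<close>,
    while the pair \<open>j\<close>, \<open>k\<close> gives \<open>j \<in> X\<close>.\<close>
  show False using bad[of i j] bad[of j k] ijk G'(1) sub1 sub2 by auto
qed

text \<open>One of the four bit patterns at \<open>i\<close> and \<open>j\<close> is excluded, so
  the density \<open>card T / 2 ^ l\<close> is multiplied by 3/4; cross-multiplication keeps this in
  the natural numbers.\<close>

lemma card_constrain:
  assumes "T \<subseteq> Pow {..<l}" "l \<le> i" "i < j"
  shows "card (constrain l T i j) * (4 * 2 ^ l) = 3 * card T * 2 ^ Suc j"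
proof -
  define A where "A = {l..<Suc j}"
  define B where "B = {\<rho>. \<rho> \<subseteq> A \<and> \<not> (i \<in> \<rho> \<and> j \<notin> \<rho>)}"
  define C where "C = {\<rho>. \<rho> \<subseteq> A \<and> i \<in> \<rho> \<and> j \<notin> \<rho>}"
  have ij: "i \<in> A" "j \<in> A" "finite A" "card A = Suc j - l" using assms by (auto simp: A_def)
  have "C = insert i ` Pow (A - {i, j})"
  proof (intro set_eqI iffI)
    fix \<rho> assume "\<rho> \<in> C"
    hence "\<rho> = insert i (\<rho> - {i})" "\<rho> - {i} \<in> Pow (A - {i, j})" by (auto simp: C_def)
    thus "\<rho> \<in> insert i ` Pow (A - {i, j})" by blast
  qed (use ij assms in \<open>auto simp: C_def\<close>)
  moreover have "inj_on (insert i) (Pow (A - {i, j}))" by (auto simp: inj_on_def)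
  ultimately have "card C = card (Pow (A - {i, j}))" by (simp add: card_image)
  also have "\<dots> = 2 ^ (Suc j - l - 2)"
    using ij assms(3) by (simp add: card_Pow card_Diff_subset)
  finally have cC: "card C * 4 = 2 ^ (Suc j - l)"
  proof -
    assume *: "card C = 2 ^ (Suc j - l - 2)"
    have "Suc j - l = Suc j - l - 2 + 2" using assms by simp
    hence "(2::nat) ^ (Suc j - l) = 2 ^ (Suc j - l - 2) * 2 ^ 2" by (metis power_add)
    thus ?thesis using * by simp
  qed
  have "Pow A = B \<union> C" "B \<inter> C = {}" by (auto simp: B_def C_def)
  moreover have "finite B" "finite C" using ij(3) by (auto simp: B_def C_def)
  ultimately have "card B + card C = 2 ^ (Suc j - l)"
    using card_Un_disjoint[of B C] card_Pow[of A] ij(3,4) by metis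
  hence cB: "card B * 4 = 3 * 2 ^ (Suc j - l)" using cC by simp
  \<comment> \<open>A string is split at position \<open>l\<close> into an element of
    \<open>T\<close> and a block satisfying the constraint.\<close>
  have "bij_betw (\<lambda>(x, y). x \<union> y) (T \<times> B) (constrain l T i j)"
  proof (rule bij_betw_byWitness[where f' = "\<lambda>\<tau>. (\<tau> \<inter> {..<l}, \<tau> - {..<l})"])
    show "\<forall>a\<in>T \<times> B. ((case a of (x, y) \<Rightarrow> x \<union> y) \<inter> {..<l}, (case a of (x, y) \<Rightarrow> x \<union> y) - {..<l}) = a"
      using assms(1) by (fastforce simp: B_def A_def)
    show "\<forall>\<tau>\<in>constrain l T i j. (case (\<tau> \<inter> {..<l}, \<tau> - {..<l}) of (x, y) \<Rightarrow> x \<union> y) = \<tau>"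
      by auto
    show "(\<lambda>(x, y). x \<union> y) ` (T \<times> B) \<subseteq> constrain l T i j"
    proof clarify
      fix x y assume xy: "x \<in> T" "y \<in> B"
      have "(x \<union> y) \<inter> {..<l} = x" using xy assms(1) by (auto simp: B_def A_def)
      moreover have "x \<union> y \<subseteq> {..<Suc j}" using xy assms by (force simp: B_def A_def)
      moreover have "x \<subseteq> {..<l}" using xy assms by blast
      hence "i \<notin> x" "j \<notin> x" using assms(2,3) by auto
      ultimately show "x \<union> y \<in> constrain l T i j" using xy by (auto simp: constrain_def B_def)
    qed
    show "(\<lambda>\<tau>. (\<tau> \<inter> {..<l}, \<tau> - {..<l})) ` constrain l T i j \<subseteq> T \<times> B"
      using assms by (auto simp: constrain_def B_def A_def)
  qed
  hence "card (constrain l T i j) = card T * card B"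
    by (simp add: bij_betw_same_card[symmetric] card_cartesian_product)
  hence "card (constrain l T i j) * (4 * 2 ^ l) = card T * (card B * 4) * 2 ^ l" by simp
  also have "\<dots> = card T * 3 * (2 ^ (Suc j - l) * 2 ^ l)" unfolding cB by simp
  also have "(2::nat) ^ (Suc j - l) * 2 ^ l = 2 ^ Suc j" using assms by (simp only: power_add[symmetric]) simp
  also have "card T * 3 * 2 ^ Suc j = 3 * card T * 2 ^ Suc j" by simp
  finally show ?thesis .
qed

text \<open>Induction from the empty string, which has density 1: each step multiplies the density
  by 3/4 and costs \<open>3 * \<delta>\<close> of the radius.\<close>

lemma large_iterate:
  assumes nd: "nondivergent p V"
    and lower: "\<And>K. K \<in> cores V \<sigma> N \<epsilon> \<beta> \<Longrightarrow> \<gamma> \<le> weight K"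
    and \<beta>: "\<beta> \<le> \<gamma> + \<delta>" "\<beta> < \<infinity>" and \<delta>: "0 < \<delta>" "\<delta> < \<infinity>"
    and e: "of_nat k * (3 * \<delta>) \<le> \<epsilon>"
  shows "\<exists>l T. T \<subseteq> Pow {..<l} \<and> card T * 4 ^ k = 3 ^ k * 2 ^ l \<and> large p (cores V \<sigma> N \<epsilon> \<beta>) N (of_nat k * (3 * \<delta>)) l T"
  using e
proof (induction k)
  case 0
  have "large p (cores V \<sigma> N \<epsilon> \<beta>) N 0 0 {{}}"
    unfolding large_def out_def using wball_self by auto
  thus ?case by (intro exI[of _ 0] exI[of _ "{{}}"]) auto
next
  case (Suc k)
  have step: "of_nat k * (3 * \<delta>) + 3 * \<delta> = of_nat (Suc k) * (3 * \<delta>)"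
    by (simp add: distrib_right add.commute)
  have "of_nat k * (3 * \<delta>) \<le> \<epsilon>" using Suc.prems unfolding step[symmetric] by (rule order_trans[rotated]) simp
  then obtain l T where T: "T \<subseteq> Pow {..<l}" "card T * 4 ^ k = 3 ^ k * 2 ^ l"
    "large p (cores V \<sigma> N \<epsilon> \<beta>) N (of_nat k * (3 * \<delta>)) l T" using Suc.IH by blast
  obtain i j where ij: "l \<le> i" "i < j" 
    "large p (cores V \<sigma> N \<epsilon> \<beta>) N (of_nat k * (3 * \<delta>) + 3 * \<delta>) (Suc j) (constrain l T i j)"
    using large_step[OF nd lower \<beta> \<delta> T(3,1)] Suc.prems step by auto
  have "card (constrain l T i j) * 4 ^ Suc k * 2 ^ l = card (constrain l T i j) * (4 * 2 ^ l) * 4 ^ k" by simp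
  also have "\<dots> = 3 * (card T * 4 ^ k) * 2 ^ Suc j" unfolding card_constrain[OF T(1) ij(1,2)] by simp
  also have "\<dots> = 3 ^ Suc k * 2 ^ Suc j * 2 ^ l" unfolding T(2) by simp
  finally have "card (constrain l T i j) * 4 ^ Suc k = 3 ^ Suc k * 2 ^ Suc j" by simp
  moreover have "constrain l T i j \<subseteq> Pow {..<Suc j}" by (auto simp: constrain_def)
  ultimately show ?case using ij(3) unfolding step by blast
qed

section \<open>Largeness is Sigma-1\<close>

text \<open>The weight of \<open>F - S\<close> below \<open>n\<close>, times \<open>2 ^ n\<close> to
  make it a natural number. Since \<open>pi1 x \<le> x < n\<close>, the subtraction in the exponent
  never truncates.\<close>

definition scaled_weight :: "nat \<Rightarrow> nat set \<Rightarrow> nat set \<Rightarrow> nat" where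
  "scaled_weight n F S = (\<Sum>x<n. of_bool (x \<in> F \<and> x \<notin> S) * 2 ^ (n - pi1 x))"

lemma pi1_le: "pi1 x \<le> x"
  by (metis le_prod_encode_1 prod.collapse prod_decode_inverse)

lemma weight_scaled_weight: "weight ((F - S) \<inter> {..<n}) = ennreal (real (scaled_weight n F S) / 2 ^ n)"
proof -
  have p: "real (2 ^ (n - pi1 x)) / 2 ^ n = (1/2) ^ pi1 x" if "x < n" for x
  proof -
    have "(2::real) ^ n = 2 ^ (n - pi1 x) * 2 ^ pi1 x" using pi1_le[of x] that by (simp add: power_add[symmetric])
    thus ?thesis by (simp add: power_one_over)
  qed
  have "weight ((F - S) \<inter> {..<n}) = ennreal (\<Sum>x\<in>(F - S) \<inter> {..<n}. (1/2) ^ pi1 x)"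
    by (simp add: weight_finite sum_ennreal)
  also have "(\<Sum>x\<in>(F - S) \<inter> {..<n}. (1/2) ^ pi1 x) = (\<Sum>x<n. of_bool (x \<in> F \<and> x \<notin> S) * (1/2::real) ^ pi1 x)"
    by (rule sum.mono_neutral_cong_left) auto
  also have "\<dots> = (\<Sum>x<n. real (of_bool (x \<in> F \<and> x \<notin> S) * 2 ^ (n - pi1 x)) / 2 ^ n)"
    by (rule sum.cong) (use p in auto)
  also have "\<dots> = real (scaled_weight n F S) / 2 ^ n" unfolding scaled_weight_def of_nat_sum sum_divide_distrib ..
  finally show ?thesis .
qed

lemma weight_le_iff_scaled_weight: "weight ((F - S) \<inter> {..<n}) \<le> ennreal (real k * (1/2) ^ a) \<longleftrightarrow> scaled_weight n F S * 2 ^ a \<le> k * 2 ^ n"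
proof -
  have "weight ((F - S) \<inter> {..<n}) \<le> ennreal (real k * (1/2) ^ a) \<longleftrightarrow> real (scaled_weight n F S) / 2 ^ n \<le> real k * (1/2) ^ a"
    unfolding weight_scaled_weight by (rule ennreal_le_iff) simp
  also have "\<dots> \<longleftrightarrow> real (scaled_weight n F S) * 2 ^ a \<le> real k * 2 ^ n" by (simp add: field_simps)
  also have "\<dots> \<longleftrightarrow> scaled_weight n F S * 2 ^ a \<le> k * 2 ^ n" 
    using of_nat_le_iff[of "scaled_weight n F S * 2 ^ a" "k * 2 ^ n", where 'a = real] by simp
  finally show ?thesis .
qed

lemma set_decode_bound: "F < 2 ^ n \<Longrightarrow> set_decode F \<subseteq> {..<n}"
proof
  fix q assume "F < 2 ^ n" "q \<in> set_decode F"
  hence "2 ^ q \<le> F"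
    by (metis div_less even_zero mem_Collect_eq not_le_imp_less set_decode_def)
  hence "(2::nat) ^ q < 2 ^ n" using \<open>F < 2 ^ n\<close> by (rule order.strict_trans1)
  thus "q \<in> {..<n}" by simp
qed

lemma set_encode_bound: "A \<subseteq> {..<n} \<Longrightarrow> set_encode A < 2 ^ n"
proof -
  assume "A \<subseteq> {..<n}"
  hence "set_encode A \<le> (\<Sum>x<n. 2 ^ x)" unfolding set_encode_def by (intro sum_mono2) auto
  also have "\<dots> < (2::nat) ^ n" by (induction n) auto
  finally show ?thesis .
qed

text \<open>\<open>bad\<close>: the prefix \<open>S\<close> of length \<open>n\<close> is refuted as the beginning of a core of weight at most \<open>(b+1)/2^h\<close>;
  \<open>good\<close>: above this prefix the output has been steered into \<open>T\<close>.\<close>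

definition bad :: "nat \<Rightarrow> nat \<Rightarrow> nat set \<Rightarrow> nat \<Rightarrow> nat \<Rightarrow> nat \<Rightarrow> nat \<Rightarrow> nat set \<Rightarrow> bool" where
  "bad c N \<sigma> a h b n S \<longleftrightarrow> (\<exists>x<N. (x \<in> S) \<noteq> (x \<in> \<sigma>)) \<or> Suc b * 2 ^ n < scaled_weight n S {} * 2 ^ h \<or>
    (\<exists>F<2 ^ n. (\<forall>x<n. x \<in> S \<longrightarrow> x \<in> set_decode F) \<and> (\<forall>x<N. x \<in> set_decode F \<longleftrightarrow> x \<in> \<sigma>) \<and>
       scaled_weight n (set_decode F) S * 2 ^ a \<le> 2 * 2 ^ n \<and>
       (\<exists>m<Suc n. \<exists>E<2 ^ m. (\<forall>x<m. x \<in> set_decode E \<longleftrightarrow> x \<in> set_decode F) \<and> Uni c \<langle>m,E\<rangle>))"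

definition good :: "nat \<Rightarrow> nat \<Rightarrow> nat set \<Rightarrow> nat \<Rightarrow> nat \<Rightarrow> nat set \<Rightarrow> nat \<Rightarrow> nat set \<Rightarrow> bool" where
  "good e N \<sigma> a l T n S \<longleftrightarrow>
    (\<exists>F<2 ^ n. (\<forall>x<n. x \<in> S \<longrightarrow> x \<in> set_decode F) \<and> (\<forall>x<N. x \<in> set_decode F \<longleftrightarrow> x \<in> \<sigma>) \<and>
       scaled_weight n (set_decode F) S * 2 ^ a \<le> 2 ^ n \<and> (\<exists>v<2 ^ l. v \<in> T \<and> out_at \<langle>n,F\<rangle> e l (set_decode v)))"

text \<open>The first conjunct bounds the measure of \<open>T\<close> by \<open>2 ^ (-3h)\<close>.
  The second is largeness in finite form: at one level \<open>n\<close> every string is refuted or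
  steered at one of its prefixes.\<close>

definition finitely_large :: "nat \<Rightarrow> nat \<Rightarrow> nat \<Rightarrow> nat set \<Rightarrow> nat \<Rightarrow> nat \<Rightarrow> nat \<Rightarrow> nat \<Rightarrow> nat set \<Rightarrow> bool" where
  "finitely_large e c N \<sigma> a h b l T \<longleftrightarrow> (\<Sum>v<2 ^ l. of_bool (v \<in> T)) * 2 ^ (3 * h) \<le> (2::nat) ^ l \<and>
     (\<exists>n. \<forall>s<2 ^ n. \<exists>n'<Suc n. N \<le> n' \<and>
        (bad c N \<sigma> a h b n' (set_decode s) \<or> good e N \<sigma> a l T n' (set_decode s)))"

lemma dec_empty: "dec (\<lambda>x. f x \<in> {})"
  using dec_const[of False] by simp

lemma sig_finitely_large:
  assumes "cpt e" "cpt c" "cpt N" "cpt u" "cpt a" "cpt h" "cpt b" "cpt l" "cpt t"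
  shows "sig (\<lambda>z. finitely_large (e z) (c z) (N z) (set_decode (u z)) (a z) (h z) (b z) (l z) (set_decode (t z)))"
  unfolding finitely_large_def bad_def good_def scaled_weight_def out_at_def
  apply (intro sig_ex sig_conj sig_ball sig_disj sig_Uni sig_Ev cpt_intros dec_intros dec_empty
      assms[THEN cpt_comp])
  apply (intro sig_dec dec_intros dec_empty cpt_intros assms[THEN cpt_comp])+
  done

section \<open>From largeness to a finite search\<close>

lemma scaled_weight_cong: "S \<inter> {..<n} = S' \<inter> {..<n} \<Longrightarrow> F \<inter> {..<n} = F' \<inter> {..<n} \<Longrightarrow> scaled_weight n F S = scaled_weight n F' S'"
  unfolding scaled_weight_def by (rule sum.cong) auto

lemma bad_cong: assumes "S \<inter> {..<n} = S' \<inter> {..<n}" "N \<le> n"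
  shows "bad c N \<sigma> a h b n S \<longleftrightarrow> bad c N \<sigma> a h b n S'"
proof -
  have "x \<in> S \<longleftrightarrow> x \<in> S'" if "x < n" for x using assms(1) that by auto
  thus ?thesis unfolding bad_def using assms(2) scaled_weight_cong[OF assms(1)] scaled_weight_cong[OF refl assms(1), of "{}"]
    by (simp cong: conj_cong imp_cong)
qed

lemma good_cong: assumes "S \<inter> {..<n} = S' \<inter> {..<n}" "N \<le> n"
  shows "good e N \<sigma> a l T n S \<longleftrightarrow> good e N \<sigma> a l T n S'"
proof -
  have "x \<in> S \<longleftrightarrow> x \<in> S'" if "x < n" for x using assms(1) that by auto
  thus ?thesis unfolding good_def using assms(2) scaled_weight_cong[OF assms(1)]
    by (simp cong: conj_cong imp_cong)
qed

abbreviation dyadic :: "nat \<Rightarrow> nat \<Rightarrow> ennreal" where "dyadic k a \<equiv> ennreal (real k * (1/2) ^ a)"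

lemma pre_decode: assumes "F < 2 ^ n" "G \<inter> {..<n} = set_decode F" shows "pre G n = \<langle>n,F\<rangle>"
  using assms by (simp add: pre_def)

text \<open>The finite witness \<open>F\<close> from \<open>bad\<close> or \<open>good\<close> is
  completed by the tail of \<open>K\<close>, which adds nothing to the difference from
  \<open>K\<close>.\<close>

lemma graft_code:
  assumes F: "F < 2 ^ n" "\<And>x. x < n \<Longrightarrow> x \<in> K \<Longrightarrow> x \<in> set_decode F"
    "\<And>x. x < N \<Longrightarrow> x \<in> set_decode F \<longleftrightarrow> x \<in> K" and w: "scaled_weight n (set_decode F) K * 2 ^ a \<le> k * 2 ^ n" and N: "N \<le> n"
  shows "set_decode F \<union> (K - {..<n}) \<in> wball K (dyadic k a) N"
    and "(set_decode F \<union> (K - {..<n})) \<inter> {..<n} = set_decode F"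
proof -
  have sub: "set_decode F \<subseteq> {..<n}" using set_decode_bound[OF F(1)] .
  have "set_decode F \<union> (K - {..<n}) - K = (set_decode F - K) \<inter> {..<n}" using sub by auto
  hence "weight (set_decode F \<union> (K - {..<n}) - K) \<le> dyadic k a" using w weight_le_iff_scaled_weight by metis
  moreover have "(set_decode F \<union> (K - {..<n})) \<inter> {..<N} = K \<inter> {..<N}" using F(3) N by auto
  moreover have "K \<subseteq> set_decode F \<union> (K - {..<n})" using F(2) by auto
  ultimately show "set_decode F \<union> (K - {..<n}) \<in> wball K (dyadic k a) N" by (simp add: wball_def)
  show "(set_decode F \<union> (K - {..<n})) \<inter> {..<n} = set_decode F" using sub by auto
qed

text \<open>Each ground for refutation contradicts one clause of \<open>cores\<close>; in the third
  case the completion of \<open>F\<close> lies in the ball around \<open>K\<close> although one of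
  its prefixes is forbidden.\<close>

lemma not_bad:
  assumes K: "K \<in> cores {x. Uni c x} \<sigma> N (dyadic 2 a) (dyadic (Suc b) h)" and N: "N \<le> n"
  shows "\<not> bad c N \<sigma> a h b n K"
proof
  assume "bad c N \<sigma> a h b n K"
  then consider "\<exists>x<N. (x \<in> K) \<noteq> (x \<in> \<sigma>)" | "Suc b * 2 ^ n < scaled_weight n K {} * 2 ^ h"
    | F where "F < 2 ^ n" "\<And>x. x < n \<Longrightarrow> x \<in> K \<Longrightarrow> x \<in> set_decode F"
      "\<And>x. x < N \<Longrightarrow> x \<in> set_decode F \<longleftrightarrow> x \<in> \<sigma>"
      "scaled_weight n (set_decode F) K * 2 ^ a \<le> 2 * 2 ^ n"
      "\<exists>m<Suc n. \<exists>E<2 ^ m. (\<forall>x<m. x \<in> set_decode E \<longleftrightarrow> x \<in> set_decode F) \<and> Uni c \<langle>m,E\<rangle>"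
    unfolding bad_def by blast
  thus False
  proof cases
    case 1
    thus ?thesis using K by (auto simp: cores_def)
  next
    case 2
    have "weight ((K - {}) \<inter> {..<n}) \<le> dyadic (Suc b) h"
      using K weight_mono[of "K \<inter> {..<n}" K] by (auto simp: cores_def intro: order_trans)
    hence "scaled_weight n K {} * 2 ^ h \<le> Suc b * 2 ^ n" unfolding weight_le_iff_scaled_weight .
    thus ?thesis using 2 by simp
  next
    case (3 F)
    let ?G = "set_decode F \<union> (K - {..<n})"
    have F3: "x \<in> set_decode F \<longleftrightarrow> x \<in> K" if "x < N" for x using 3(3)[OF that] K that by (auto simp: cores_def)
    note g = graft_code[OF 3(1) 3(2) F3 3(4) N]
    obtain m E where mE: "m < Suc n" "E < 2 ^ m" "\<And>x. x < m \<Longrightarrow> x \<in> set_decode E \<longleftrightarrow> x \<in> set_decode F" "Uni c \<langle>m,E\<rangle>"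
      using 3(5) by blast
    have "set_decode E \<subseteq> {..<m}" using set_decode_bound[OF mE(2)] .
    hence "?G \<inter> {..<m} = set_decode E" using mE(1,3) by auto
    hence "pre ?G m = \<langle>m,E\<rangle>" using pre_decode[OF mE(2)] by blast
    moreover have "?G \<in> avoid {x. Uni c x}" using g(1) K by (auto simp: cores_def)
    ultimately show ?thesis using mE(4) by (metis (mono_tags, lifting) avoid_def mem_Collect_eq)
  qed
qed

text \<open>Every clause of \<open>cores\<close> is closed, so its failure shows at a finite stage:
  a wrong bit, a prefix that is too heavy, or a forbidden prefix of some set in the ball.\<close>

lemma bad_complete:
  assumes K: "K \<notin> cores {x. Uni c x} \<sigma> N (dyadic 2 a) (dyadic (Suc b) h)" and \<sigma>: "\<sigma> \<subseteq> {..<N}"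
  shows "\<exists>n\<ge>N. bad c N \<sigma> a h b n K"
proof (cases "K \<inter> {..<N} = \<sigma>")
  case False
  hence "\<exists>x<N. (x \<in> K) \<noteq> (x \<in> \<sigma>)" using \<sigma> by auto
  thus ?thesis unfolding bad_def by blast
next
  case KN: True
  show ?thesis
  proof (cases "weight K \<le> dyadic (Suc b) h")
    case False
    then obtain n where "\<not> weight (K \<inter> {..<n}) \<le> dyadic (Suc b) h" using weight_le_prefix by blast
    moreover have "weight (K \<inter> {..<n}) \<le> weight ((K - {}) \<inter> {..<max n N})" by (rule weight_mono) auto
    ultimately have "\<not> weight ((K - {}) \<inter> {..<max n N}) \<le> dyadic (Suc b) h" using order_trans by blast
    hence "Suc b * 2 ^ max n N < scaled_weight (max n N) K {} * 2 ^ h" unfolding weight_le_iff_scaled_weight by simp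
    thus ?thesis unfolding bad_def using max.cobounded2 by blast
  next
    case True
    then obtain G m where G: "G \<in> wball K (dyadic 2 a) N" "Uni c (pre G m)"
      using K KN unfolding cores_def avoid_def by blast
    define n where "n = max m N"
    define F where "F = set_encode (G \<inter> {..<n})"
    define E where "E = set_encode (G \<inter> {..<m})"
    have dF: "set_decode F = G \<inter> {..<n}" "set_decode E = G \<inter> {..<m}" by (simp_all add: F_def E_def)
    have "weight ((set_decode F - K) \<inter> {..<n}) \<le> weight (G - K)" by (rule weight_mono) (auto simp: dF)
    also have "\<dots> \<le> dyadic 2 a" using G(1) by (simp add: wball_def)
    finally have "scaled_weight n (set_decode F) K * 2 ^ a \<le> 2 * 2 ^ n" unfolding weight_le_iff_scaled_weight .
    moreover have "F < 2 ^ n" "E < 2 ^ m" unfolding F_def E_def by (auto intro: set_encode_bound)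
    moreover have "m < Suc n" and "N \<le> n" by (auto simp: n_def)
    moreover have "G \<inter> {..<N} = \<sigma>" using G(1) KN by (simp add: wball_def)
    moreover have "\<forall>x<m. x \<in> set_decode E \<longleftrightarrow> x \<in> set_decode F" by (auto simp: dF n_def)
    moreover have "Uni c \<langle>m,E\<rangle>" using G(2) by (simp add: pre_def E_def)
    moreover have "\<forall>x<n. x \<in> K \<longrightarrow> x \<in> set_decode F" using G(1) by (auto simp: dF wball_def)
    moreover have "\<forall>x<N. x \<in> set_decode F \<longleftrightarrow> x \<in> \<sigma>"
      using \<open>G \<inter> {..<N} = \<sigma>\<close> \<open>N \<le> n\<close> unfolding dF by auto
    ultimately show ?thesis unfolding bad_def by blast
  qed
qed

text \<open>Use principle: the first \<open>l\<close> bits of output depend only on a finite prefix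
  of \<open>G\<close>.\<close>

lemma good_complete:
  assumes G: "G \<in> wball K (dyadic 1 a) N" "out p G l \<tau>" and \<tau>: "\<tau> \<subseteq> {..<l}" "set_encode \<tau> \<in> T"
    and K: "K \<inter> {..<N} = \<sigma>"
  shows "\<exists>n\<ge>N. good (rcode p) N \<sigma> a l T n K"
proof -
  obtain n0 where n0: "\<And>n. n \<ge> n0 \<Longrightarrow> out_at (pre G n) (rcode p) l \<tau>" using out_complete[OF G(2)] by blast
  define n where "n = max n0 N"
  define F where "F = set_encode (G \<inter> {..<n})"
  have dF: "set_decode F = G \<inter> {..<n}" by (simp add: F_def)
  have "weight ((set_decode F - K) \<inter> {..<n}) \<le> weight (G - K)" by (rule weight_mono) (auto simp: dF)
  also have "\<dots> \<le> dyadic 1 a" using G(1) by (simp add: wball_def)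
  finally have "scaled_weight n (set_decode F) K * 2 ^ a \<le> 1 * 2 ^ n" unfolding weight_le_iff_scaled_weight .
  moreover have "F < 2 ^ n" unfolding F_def by (auto intro: set_encode_bound)
  moreover have "N \<le> n" by (auto simp: n_def)
  moreover have "G \<inter> {..<N} = \<sigma>" using G(1) K by (simp add: wball_def)
  moreover have "\<forall>x<n. x \<in> K \<longrightarrow> x \<in> set_decode F" using G(1) by (auto simp: dF wball_def)
  moreover have "\<forall>x<N. x \<in> set_decode F \<longleftrightarrow> x \<in> \<sigma>"
    using \<open>G \<inter> {..<N} = \<sigma>\<close> \<open>N \<le> n\<close> unfolding dF by auto
  moreover have "out_at \<langle>n,F\<rangle> (rcode p) l (set_decode (set_encode \<tau>))"
    using n0[of n] \<tau>(1) by (simp add: n_def pre_def F_def finite_subset[OF \<tau>(1)])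
  moreover have "set_encode \<tau> < 2 ^ l" using \<tau>(1) by (rule set_encode_bound)
  ultimately show ?thesis unfolding good_def using \<tau>(2) by auto
qed

text \<open>If no level sufficed, compactness would yield a \<open>K\<close> none of whose prefixes
  is bad or good. Not being refuted, \<open>K\<close> is a core, and then largeness makes one of its
  prefixes good.\<close>

lemma finitely_large_complete:
  assumes lg: "large p (cores {x. Uni c x} \<sigma> N (dyadic 2 a) (dyadic (Suc b) h)) N (dyadic 1 a) l T"
    and T: "T \<subseteq> Pow {..<l}" "card T * 2 ^ (3 * h) \<le> 2 ^ l" and \<sigma>: "\<sigma> \<subseteq> {..<N}"
  shows "finitely_large (rcode p) c N \<sigma> a h b l (set_encode ` T)"
proof -
  have fT: "finite T" using T(1) finite_subset by blast
  have "(\<Sum>v<2 ^ l. of_bool (v \<in> set_encode ` T)) = card ({..<2 ^ l} \<inter> set_encode ` T)"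
    by (simp add: of_bool_def sum.If_cases Int_def)
  also have "\<dots> \<le> card (set_encode ` T)" using fT by (intro card_mono) auto
  also have "\<dots> \<le> card T" using fT by (rule card_image_le)
  finally have "(\<Sum>v<2 ^ l. of_bool (v \<in> set_encode ` T)) * 2 ^ (3 * h) \<le> card T * 2 ^ (3 * h)" by simp
  hence 1: "(\<Sum>v<2 ^ l. of_bool (v \<in> set_encode ` T)) * 2 ^ (3 * h) \<le> (2::nat) ^ l" using T(2) by linarith
  let ?bg = "\<lambda>n S. bad c N \<sigma> a h b n S \<or> good (rcode p) N \<sigma> a l (set_encode ` T) n S"
  have 2: "\<exists>n. \<forall>s<2 ^ n. \<exists>n'<Suc n. N \<le> n' \<and> ?bg n' (set_decode s)"
  proof (rule ccontr)
    assume no: "\<not> ?thesis"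
    have "\<exists>K. \<forall>n. \<forall>n'\<le>n. N \<le> n' \<longrightarrow> \<not> ?bg n' K"
    proof (rule weak_koenig)
      fix n
      obtain s where "\<And>n'. n' < Suc n \<Longrightarrow> N \<le> n' \<Longrightarrow> \<not> ?bg n' (set_decode s)" using no by blast
      thus "\<exists>K. \<forall>n'\<le>n. N \<le> n' \<longrightarrow> \<not> ?bg n' K" by (intro exI[of _ "set_decode s"]) (simp add: less_Suc_eq_le)
    next
      fix n K K' assume eq: "K \<inter> {..<n} = K' \<inter> {..<n}" and *: "\<forall>n'\<le>n. N \<le> n' \<longrightarrow> \<not> ?bg n' K"
      show "\<forall>n'\<le>n. N \<le> n' \<longrightarrow> \<not> ?bg n' K'"
      proof (intro allI impI)
        fix n' assume n': "n' \<le> n" "N \<le> n'"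
        have e: "K \<inter> {..<n'} = K' \<inter> {..<n'}" using Int_lessThan_mono[OF eq n'(1)] .
        show "\<not> ?bg n' K'" using *[rule_format, OF n'] unfolding bad_cong[OF e n'(2)] good_cong[OF e n'(2)] .
      qed
    qed simp
    then obtain K where K: "\<And>n. N \<le> n \<Longrightarrow> \<not> bad c N \<sigma> a h b n K"
      "\<And>n. N \<le> n \<Longrightarrow> \<not> good (rcode p) N \<sigma> a l (set_encode ` T) n K" by blast
    hence KH: "K \<in> cores {x. Uni c x} \<sigma> N (dyadic 2 a) (dyadic (Suc b) h)" using bad_complete[OF _ \<sigma>] by blast
    then obtain G \<tau> where "G \<in> wball K (dyadic 1 a) N" "\<tau> \<in> T" "out p G l \<tau>" using lg unfolding large_def by blast
    moreover have "K \<inter> {..<N} = \<sigma>" using KH by (simp add: cores_def)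
    ultimately have "\<exists>n\<ge>N. good (rcode p) N \<sigma> a l (set_encode ` T) n K"
      using T(1) by (intro good_complete) auto
    thus False using K(2) by blast
  qed
  show ?thesis unfolding finitely_large_def using 1 2 by (rule conjI)
qed

text \<open>Prefixes of a core are never bad, so the finite search can only have ended with a good
  one.\<close>

lemma finitely_large_sound:
  assumes "finitely_large e c N \<sigma> a h b l T" and K: "K \<in> cores {x. Uni c x} \<sigma> N (dyadic 2 a) (dyadic (Suc b) h)"
  shows "\<exists>n\<ge>N. good e N \<sigma> a l T n K"
proof -
  obtain n where n: "\<And>s. s < 2 ^ n \<Longrightarrow> \<exists>n'<Suc n. N \<le> n' \<and>
        (bad c N \<sigma> a h b n' (set_decode s) \<or> good e N \<sigma> a l T n' (set_decode s))"
    using assms(1) unfolding finitely_large_def by blast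
  have "set_encode (K \<inter> {..<n}) < 2 ^ n" by (rule set_encode_bound) simp
  from n[OF this] obtain n' where n': "n' < Suc n" "N \<le> n'"
    "bad c N \<sigma> a h b n' (K \<inter> {..<n}) \<or> good e N \<sigma> a l T n' (K \<inter> {..<n})" by auto
  have e: "(K \<inter> {..<n}) \<inter> {..<n'} = K \<inter> {..<n'}" using n'(1) by auto
  show ?thesis using n' bad_cong[OF e n'(2)] good_cong[OF e n'(2)] not_bad[OF K n'(2)] by blast
qed

lemma large_mono: "large p \<H> N e l T \<Longrightarrow> e \<le> e' \<Longrightarrow> large p \<H> N e' l T"
  unfolding large_def using wball_mono by blast

text \<open>Choosing \<open>b\<close> minimal makes all cores of weight at most \<open>(b+1)/2^h\<close> have nearly equal weight,
  so that two of them agreeing on a long prefix differ by little.\<close>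
lemma finitely_large_exists:
  assumes nd: "nondivergent p {x. Uni c x}"
    and K0: "weight K0 \<le> ennreal (2 ^ h)" "wball K0 (dyadic 2 a) N \<subseteq> avoid {x. Uni c x}"
    and h: "27 * real h * (1/2) ^ h \<le> (1/2) ^ a"
  shows "\<exists>b<2 ^ (2 * h). cores {x. Uni c x} (K0 \<inter> {..<N}) N (dyadic 2 a) (dyadic (Suc b) h) \<noteq> {} \<and>
    (\<exists>l T. finite T \<and> finitely_large (rcode p) c N (K0 \<inter> {..<N}) a h b l T)"
proof -
  let ?V = "{x. Uni c x}" and ?\<sigma> = "K0 \<inter> {..<N}"
  let ?H = "\<lambda>b. cores ?V ?\<sigma> N (dyadic 2 a) (dyadic (Suc b) h)"
  \<comment> \<open>The last guess permits weight \<open>2 ^ (2 * h) / 2 ^ h = 2 ^ h\<close>, the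
    bound on \<open>K0\<close>; hence some guess in the range succeeds.\<close>
  have "K0 \<in> ?H (2 ^ (2 * h) - 1)"
  proof -
    have "real (Suc (2 ^ (2 * h) - 1)) * (1/2) ^ h = 2 ^ h"
      by (simp add: power_mult_distrib power_one_over power2_eq_square mult_2 power_add)
    thus ?thesis using K0 by (simp add: cores_def)
  qed
  hence ex: "\<exists>b. ?H b \<noteq> {}" by blast
  define b where "b = (LEAST b. ?H b \<noteq> {})"
  have b: "?H b \<noteq> {}" unfolding b_def using LeastI_ex[OF ex] .
  have "b \<le> 2 ^ (2 * h) - 1" unfolding b_def by (rule Least_le) (use \<open>K0 \<in> ?H (2 ^ (2 * h) - 1)\<close> in blast)
  moreover have "(0::nat) < 2 ^ (2 * h)" by simp
  ultimately have b1: "b < 2 ^ (2 * h)" by linarith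
  \<comment> \<open>A lighter core would already belong to the guess \<open>b - 1\<close>; for
    \<open>b = 0\<close> the bound is trivial.\<close>
  have lower: "dyadic b h \<le> weight K" if "K \<in> ?H b" for K
  proof (cases b)
    case (Suc b')
    show ?thesis
    proof (rule ccontr)
      assume "\<not> ?thesis"
      hence "K \<in> ?H b'" using that Suc by (auto simp: cores_def)
      moreover have "\<not> (?H b' \<noteq> {})" using not_less_Least[of b' "\<lambda>b. ?H b \<noteq> {}"] Suc unfolding b_def by simp
      ultimately show False by blast
    qed
  qed simp
  have \<beta>: "dyadic (Suc b) h \<le> dyadic b h + dyadic 1 h"
    by (simp add: ennreal_plus[symmetric] distrib_right del: ennreal_plus)
  have fin: "dyadic (Suc b) h < \<infinity>" and pos: "0 < dyadic 1 h" and fin': "dyadic 1 h < \<infinity>" by simp_all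
  \<comment> \<open>There are \<open>9 * h\<close> steps at cost \<open>3 / 2 ^ h\<close> each, in
    total \<open>27 * h / 2 ^ h\<close>.\<close>
  have k: "of_nat (9 * h) * (3 * dyadic 1 h) \<le> dyadic 1 a"
  proof -
    have "of_nat (9 * h) * (3 * dyadic 1 h) = ennreal (real (9 * h) * (3 * (real 1 * (1/2) ^ h)))"
      using ennreal_mult[of "real (9 * h)" "3 * (real 1 * (1/2) ^ h)"] ennreal_mult[of 3 "real 1 * (1/2) ^ h"]
      by (simp only: ennreal_of_nat_eq_real_of_nat) simp
    also have "\<dots> \<le> dyadic 1 a" using h by (intro ennreal_leI) (simp add: algebra_simps)
    finally show ?thesis .
  qed
  also have "dyadic 1 a \<le> dyadic 2 a" by (intro ennreal_leI) simp
  finally have k2: "of_nat (9 * h) * (3 * dyadic 1 h) \<le> dyadic 2 a" .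
  have "\<exists>l T. T \<subseteq> Pow {..<l} \<and> card T * 4 ^ (9 * h) = 3 ^ (9 * h) * 2 ^ l \<and>
      large p (?H b) N (of_nat (9 * h) * (3 * dyadic 1 h)) l T"
    by (rule large_iterate[OF nd _ \<beta> fin pos fin' k2]) (rule lower)
  then obtain l T where T: "T \<subseteq> Pow {..<l}" "card T * 4 ^ (9 * h) = 3 ^ (9 * h) * 2 ^ l"
    "large p (?H b) N (of_nat (9 * h) * (3 * dyadic 1 h)) l T" by (elim exE conjE)
  have "card T * 2 ^ (3 * h) * 4 ^ (9 * h) = (card T * 4 ^ (9 * h)) * 2 ^ (3 * h)" by simp
  also have "\<dots> = (3 ^ 9) ^ h * (2 ^ 3) ^ h * 2 ^ l" unfolding T(2) by (simp add: power_mult)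
  also have "\<dots> = (3 ^ 9 * 2 ^ 3) ^ h * 2 ^ l" by (simp only: power_mult_distrib)
  \<comment> \<open>\<open>3 ^ 9 * 2 ^ 3 = 157464\<close> is below \<open>4 ^ 9 = 262144\<close>;
    this is why nine steps are made per unit of \<open>h\<close>.\<close>
  also have "\<dots> \<le> (4 ^ 9) ^ h * 2 ^ l" by (intro mult_right_mono power_mono) auto
  also have "\<dots> = 2 ^ l * 4 ^ (9 * h)" by (simp add: power_mult)
  finally have "card T * 2 ^ (3 * h) \<le> 2 ^ l" by simp
  hence "finitely_large (rcode p) c N ?\<sigma> a h b l (set_encode ` T)"
    using finitely_large_complete[OF large_mono[OF T(3) k] T(1)] by simp
  moreover have "finite (set_encode ` T)" using T(1) finite_subset by blast
  ultimately show ?thesis using b1 b by blast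
qed

section \<open>The test\<close>

definition bits :: "nat \<Rightarrow> nat \<Rightarrow> bool list" where
  "bits l v = map (\<lambda>i. i \<in> set_decode v) [0..<l]"

lemma length_bits [simp]: "length (bits l v) = l"
  by (simp add: bits_def)

lemma cpt_code_bits: assumes "cpt l" "cpt v" shows "cpt (\<lambda>x. code_str (bits (l x) (v x)))"
proof -
  \<comment> \<open>The code is built from the end of the list: stage \<open>k\<close> holds the
    last \<open>k\<close> bits.\<close>
  have *: "list_encode (map of_bool (map (\<lambda>i. i \<in> set_decode u) [m - k..<m])) =
      rec_nat 0 (\<lambda>k y. Suc \<langle>of_bool (m - Suc k \<in> set_decode u),y\<rangle>) k" if "k \<le> m" for m u k
    using that
  proof (induction k)
    case (Suc k)
    hence "[m - Suc k..<m] = (m - Suc k) # [m - k..<m]"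
      by (metis Suc_diff_Suc Suc_le_lessD diff_less upt_conv_Cons zero_less_Suc order_less_le_trans)
    thus ?case using Suc by simp
  qed simp
  have "code_str (bits m u) = rec_nat 0 (\<lambda>k y. Suc \<langle>of_bool (m - Suc k \<in> set_decode u),y\<rangle>) m" for m u
    using *[of m m u] by (simp add: code_str_def bits_def)
  moreover have "cpt (\<lambda>x. rec_nat 0 (\<lambda>k y. Suc \<langle>of_bool (l x - Suc k \<in> set_decode (v x)),y\<rangle>) (l x))"
    by (intro cpt_rec cpt_intros dec_intros assms[THEN cpt_comp])
  ultimately show ?thesis by simp
qed

lemma cyl_single: "cyl {\<sigma>} = prod_emb UNIV (\<lambda>_. measure_pmf (bernoulli_pmf (1/2))) {..<length \<sigma>}
    (Pi\<^sub>E {..<length \<sigma>} (\<lambda>i. {\<sigma> ! i}))"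
  by (auto simp: cyl_def prod_emb_def PiE_def Pi_def extensional_def restrict_def)

lemma cyl_single_sets: "cyl {\<sigma>} \<in> sets cantor"
  unfolding cyl_single cantor_def by (rule sets_PiM_I) auto

lemma emeasure_cyl_single: "emeasure cantor (cyl {\<sigma>}) = ennreal ((1/2) ^ length \<sigma>)"
proof -
  have "emeasure cantor (cyl {\<sigma>}) = (\<Prod>i<length \<sigma>. emeasure (measure_pmf (bernoulli_pmf (1/2))) {\<sigma> ! i})"
    unfolding cyl_single cantor_def
    by (rule emeasure_PiM_emb) (auto intro: measure_pmf.prob_space_axioms)
  also have "\<dots> = (\<Prod>i<length \<sigma>. ennreal (1/2))"
    by (rule prod.cong) (auto simp: emeasure_pmf_single pmf_bernoulli_True pmf_bernoulli_False split: if_splits intro!: arg_cong[where f = ennreal] simp: pmf_def[symmetric])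
  also have "\<dots> = ennreal ((1/2) ^ length \<sigma>)"
    by (simp only: prod_constant card_lessThan) (rule ennreal_power, simp)
  finally show ?thesis .
qed

lemma cyl_Union: "cyl U = (\<Union>\<sigma>\<in>U. cyl {\<sigma>})"
  by (auto simp: cyl_def)

lemma cyl_sets: "cyl U \<in> sets cantor"
  unfolding cyl_Union[of U] by (rule sets.countable_UN') (auto intro: cyl_single_sets)

lemma emeasure_cyl_level:
  "emeasure cantor (cyl {bits l v | v. v < 2 ^ l \<and> v \<in> T}) \<le> ennreal (real (\<Sum>v<2 ^ l. of_bool (v \<in> T)) * (1/2) ^ l)"
proof -
  let ?A = "{..<2 ^ l} \<inter> T"
  have "cyl {bits l v | v. v < 2 ^ l \<and> v \<in> T} = (\<Union>v\<in>?A. cyl {bits l v})"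
    by (auto simp: cyl_def)
  also have "emeasure cantor \<dots> \<le> (\<Sum>v\<in>?A. emeasure cantor (cyl {bits l v}))"
    by (rule emeasure_subadditive_finite) (auto intro: cyl_sets)
  also have "\<dots> = of_nat (card ?A) * ennreal ((1/2) ^ l)" by (simp add: emeasure_cyl_single)
  also have "\<dots> = ennreal (real (card ?A) * (1/2) ^ l)"
    by (simp add: ennreal_mult ennreal_of_nat_eq_real_of_nat)
  also have "card ?A = (\<Sum>v<2 ^ l. of_bool (v \<in> T))" by (simp add: of_bool_def sum.If_cases Int_def)
  finally show ?thesis .
qed

text \<open>\<open>q = \<langle>d,\<langle>c,\<langle>\<langle>N,u\<rangle>,a\<rangle>\<rangle>\<rangle>\<close> codes a condition; the padding \<open>d\<close> only serves to make \<open>q\<close> large.\<close>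

definition instance_large :: "rf \<Rightarrow> nat \<Rightarrow> nat \<Rightarrow> nat \<Rightarrow> nat \<Rightarrow> nat set \<Rightarrow> bool" where
  "instance_large p q n b l T = finitely_large (rcode p) (pi1 (pi2 q)) (pi1 (pi1 (pi2 (pi2 q)))) (set_decode (pi2 (pi1 (pi2 (pi2 q)))))
     (pi2 (pi2 (pi2 q))) (n + q + 1) b l T"

text \<open>\<open>T0\<close> only certifies that the search succeeds. The set put into the test may
  be another one, since a single set is enumerated for each search.\<close>

definition captures :: "rf \<Rightarrow> (nat \<Rightarrow> bool list set) \<Rightarrow> bool" where
  "captures p U \<longleftrightarrow> (\<forall>q n b l0 T0. finite T0 \<longrightarrow> instance_large p q n b l0 T0 \<longrightarrow> b < 2 ^ (2 * (n + q + 1)) \<longrightarrow>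
     (\<exists>l T. instance_large p q n b l T \<and> {bits l v | v. v < 2 ^ l \<and> v \<in> T} \<subseteq> U n))"

text \<open>Let \<open>h = n + q + 1\<close>. Each condition \<open>q\<close> and guess
  \<open>b\<close> contributes one set of measure at most \<open>2 ^ (-3h)\<close>; the
  \<open>2 ^ (2h)\<close> guesses add up to \<open>2 ^ (-h)\<close>, and summing over
  \<open>q\<close> gives \<open>2 ^ (-n)\<close>.\<close>

lemma capturing_test_exists: "\<exists>U. mlof_test U \<and> captures p U"
proof -
  let ?P = "\<lambda>z y. instance_large p (pi1 z) (pi1 (pi2 z)) (pi2 (pi2 z)) (pi1 y) (set_decode (pi2 y))"
  have "sig (\<lambda>z. ?P (pi1 z) (pi2 z))"
    unfolding instance_large_def by (intro sig_finitely_large cpt_intros)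
  \<comment> \<open>Uniformization selects at most one set per search; without it a cell could
    collect many sets and exceed its measure.\<close>
  then obtain Q where Q: "sig (\<lambda>z. Q (pi1 z) (pi2 z))" "\<And>x y. Q x y \<Longrightarrow> ?P x y"
    "\<And>x y y'. Q x y \<Longrightarrow> Q x y' \<Longrightarrow> y = y'" "\<And>x y. ?P x y \<Longrightarrow> \<exists>y'. Q x y'"
    by (rule sig_uniformize) blast
  define cell where "cell n q b = {bits l v | l t v. Q \<langle>q,\<langle>n,b\<rangle>\<rangle> \<langle>l,t\<rangle> \<and> v < 2 ^ l \<and> v \<in> set_decode t}" for n q b
  define U where "U n = (\<Union>q. \<Union>b<2 ^ (2 * (n + q + 1)). cell n q b)" for n
  have cell: "emeasure cantor (cyl (cell n q b)) \<le> ennreal ((1/2) ^ (3 * (n + q + 1)))" for n q b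
  proof (cases "\<exists>y. Q \<langle>q,\<langle>n,b\<rangle>\<rangle> y")
    case False
    hence "cell n q b = {}" by (auto simp: cell_def)
    thus ?thesis by (simp add: cyl_def)
  next
    case True
    then obtain l t where lt: "Q \<langle>q,\<langle>n,b\<rangle>\<rangle> \<langle>l,t\<rangle>" by (metis prod.collapse prod_decode_inverse)
    have eq: "l' = l \<and> t' = t" if "Q \<langle>q,\<langle>n,b\<rangle>\<rangle> \<langle>l',t'\<rangle>" for l' t' using Q(3)[OF lt that] by simp
    have "cell n q b = {bits l v | v. v < 2 ^ l \<and> v \<in> set_decode t}"
      unfolding cell_def using eq lt by blast
    moreover have "instance_large p q n b l (set_decode t)" using Q(2)[OF lt] by simp
    hence *: "(\<Sum>v<2 ^ l. of_bool (v \<in> set_decode t)) * 2 ^ (3 * (n + q + 1)) \<le> (2::nat) ^ l"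
      unfolding instance_large_def finitely_large_def by blast
    let ?S = "\<Sum>v<2 ^ l. of_bool (v \<in> set_decode t) :: nat"
    have "real (?S * 2 ^ (3 * (n + q + 1))) \<le> real (2 ^ l)" using * of_nat_le_iff by blast
    hence "real ?S * (1/2) ^ l \<le> (1/2) ^ (3 * (n + q + 1))" by (simp only: of_nat_mult of_nat_power of_nat_numeral) (simp add: field_simps)
    ultimately show ?thesis using emeasure_cyl_level[of l "set_decode t"] by (metis (no_types, lifting) ennreal_leI order_trans)
  qed
  have half_power: "(2::real) ^ (2 * k) * (1/2) ^ (3 * k) = (1/2) ^ k" for k
    unfolding power_mult power_mult_distrib[symmetric] by (simp add: power3_eq_cube)
  have "emeasure cantor (cyl (U n)) \<le> ennreal ((1/2) ^ n)" for n
  proof -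
    have "cyl (U n) = (\<Union>q. \<Union>b<2 ^ (2 * (n + q + 1)). cyl (cell n q b))"
      by (auto simp: U_def cyl_def)
    also have "emeasure cantor \<dots> \<le> (\<Sum>q. emeasure cantor (\<Union>b<2 ^ (2 * (n + q + 1)). cyl (cell n q b)))"
      by (rule emeasure_subadditive_countably) (auto intro: cyl_sets)
    also have "\<dots> \<le> (\<Sum>q. ennreal ((1/2) ^ (n + q + 1)))"
    proof (rule suminf_le)
      fix q
      have "emeasure cantor (\<Union>b<2 ^ (2 * (n + q + 1)). cyl (cell n q b)) \<le> (\<Sum>b<2 ^ (2 * (n + q + 1)). emeasure cantor (cyl (cell n q b)))"
        by (rule emeasure_subadditive_finite) (auto intro: cyl_sets)
      also have "\<dots> \<le> (\<Sum>b<(2::nat) ^ (2 * (n + q + 1)). ennreal ((1/2) ^ (3 * (n + q + 1))))"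
        by (rule sum_mono) (rule cell)
      also have "\<dots> = ennreal (2 ^ (2 * (n + q + 1)) * (1/2) ^ (3 * (n + q + 1)))"
        by (simp add: ennreal_mult ennreal_of_nat_eq_real_of_nat)
      also have "(2::real) ^ (2 * (n + q + 1)) * (1/2) ^ (3 * (n + q + 1)) = (1/2) ^ (n + q + 1)"
        using half_power[of "n + q + 1"] .
      finally show "emeasure cantor (\<Union>b<2 ^ (2 * (n + q + 1)). cyl (cell n q b)) \<le> ennreal ((1/2) ^ (n + q + 1))" .
    qed auto
    also have "\<dots> = ennreal ((1/2) ^ n)"
    proof -
      have "(\<lambda>q. (1/2::real) ^ (n + 1) * (1/2) ^ q) sums ((1/2) ^ (n + 1) * 2)"
        using geometric_sums[of "1/2::real"] by (intro sums_mult) simp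
      hence "(\<lambda>q. (1/2::real) ^ (n + q + 1)) sums ((1/2) ^ n)" by (simp add: power_add mult_ac)
      thus ?thesis by (intro suminf_ennreal_eq) auto
    qed
    finally show ?thesis .
  qed
  moreover have "ce {\<langle>n,code_str \<sigma>\<rangle> | n \<sigma>. \<sigma> \<in> U n}"
  proof -
    let ?R = "\<lambda>x. \<exists>q b l t v. pi2 x = code_str (bits l v) \<and> b < 2 ^ (2 * (pi1 x + q + 1)) \<and>
      Q \<langle>q,\<langle>pi1 x,b\<rangle>\<rangle> \<langle>l,t\<rangle> \<and> v < 2 ^ l \<and> v \<in> set_decode t"
    have QQ: "cpt f \<Longrightarrow> cpt g \<Longrightarrow> sig (\<lambda>z. Q (f z) (g z))" for f g
      using sig_subst[OF Q(1) cpt_pair, of f g] by simp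
    have "sig ?R"
      by (intro sig_ex sig_conj QQ sig_dec dec_intros cpt_code_bits cpt_intros)
    moreover have "{\<langle>n,code_str \<sigma>\<rangle> | n \<sigma>. \<sigma> \<in> U n} = {x. ?R x}"
    proof (intro set_eqI iffI)
      fix x assume "x \<in> {\<langle>n,code_str \<sigma>\<rangle> | n \<sigma>. \<sigma> \<in> U n}"
      then obtain n \<sigma> where x: "x = \<langle>n,code_str \<sigma>\<rangle>" "\<sigma> \<in> U n" by blast
      then obtain q b l t v where "b < 2 ^ (2 * (n + q + 1))" "\<sigma> = bits l v" "Q \<langle>q,\<langle>n,b\<rangle>\<rangle> \<langle>l,t\<rangle>" "v < 2 ^ l" "v \<in> set_decode t"
        unfolding U_def cell_def by blast
      hence "?R x" unfolding x(1) prod_encode_inverse fst_conv snd_conv by blast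
      thus "x \<in> {x. ?R x}" by (rule CollectI)
    next
      fix x assume "x \<in> {x. ?R x}"
      then obtain q b l t v where *: "pi2 x = code_str (bits l v)" "b < 2 ^ (2 * (pi1 x + q + 1))"
        "Q \<langle>q,\<langle>pi1 x,b\<rangle>\<rangle> \<langle>l,t\<rangle>" "v < 2 ^ l" "v \<in> set_decode t" by blast
      have "bits l v \<in> U (pi1 x)" unfolding U_def cell_def using *(2-5) by blast
      moreover have "x = \<langle>pi1 x,code_str (bits l v)\<rangle>" using *(1) by (metis prod.collapse prod_decode_inverse)
      ultimately show "x \<in> {\<langle>n,code_str \<sigma>\<rangle> | n \<sigma>. \<sigma> \<in> U n}" by blast
    qed
    ultimately show ?thesis using sig_imp_ce by simp
  qed
  ultimately have test: "mlof_test U" unfolding mlof_test_def by blast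
  have "\<exists>l T. instance_large p q n b l T \<and> {bits l v | v. v < 2 ^ l \<and> v \<in> T} \<subseteq> U n"
    if "finite T0" "instance_large p q n b l0 T0" "b < 2 ^ (2 * (n + q + 1))" for q n b l0 T0
  proof -
    have "?P \<langle>q,\<langle>n,b\<rangle>\<rangle> \<langle>l0,set_encode T0\<rangle>" using that by simp
    then obtain y where y: "Q \<langle>q,\<langle>n,b\<rangle>\<rangle> y" using Q(4) by blast
    hence "instance_large p q n b (pi1 y) (set_decode (pi2 y))" using Q(2) by fastforce
    moreover have "Q \<langle>q,\<langle>n,b\<rangle>\<rangle> \<langle>pi1 y,pi2 y\<rangle>" using y by simp
    hence "{bits (pi1 y) v | v. v < 2 ^ pi1 y \<and> v \<in> set_decode (pi2 y)} \<subseteq> U n"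
      unfolding U_def cell_def using that(3) by blast
    ultimately show ?thesis by blast
  qed
  hence "captures p U" unfolding captures_def by (intro allI impI)
  thus ?thesis using test by (intro exI conjI)
qed

section \<open>Forcing the requirements\<close>

lemma avoid_Un: "avoid (V \<union> V') = avoid V \<inter> avoid V'"
  by (auto simp: avoid_def)

lemma ce_Un: assumes "ce V" "sig P" shows "ce (V \<union> {x. P x})"
  using sig_imp_ce[OF sig_disj[OF ce_sig[OF assms(1) cpt_id] assms(2)]] by (simp add: Un_def)

text \<open>Only strings of length at least \<open>n\<close> are forbidden, since shorter ones lack
  some of the bits to be compared.\<close>

definition fix_prefix :: "nat \<Rightarrow> nat set \<Rightarrow> nat set" where
  "fix_prefix n \<sigma> = {s. n \<le> pi1 s \<and> (\<exists>x<n. (x \<in> set_decode (pi2 s)) \<noteq> (x \<in> \<sigma>))}"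

lemma avoid_fix_prefix: assumes "\<sigma> \<subseteq> {..<n}" shows "G \<in> avoid (fix_prefix n \<sigma>) \<longleftrightarrow> G \<inter> {..<n} = \<sigma>"
proof
  assume G: "G \<in> avoid (fix_prefix n \<sigma>)"
  hence "pre G n \<notin> fix_prefix n \<sigma>" by (auto simp: avoid_def)
  hence "\<forall>x<n. (x \<in> G \<inter> {..<n}) = (x \<in> \<sigma>)" unfolding fix_prefix_def by (simp add: pre_def)
  thus "G \<inter> {..<n} = \<sigma>" using assms by auto
next
  assume G: "G \<inter> {..<n} = \<sigma>"
  show "G \<in> avoid (fix_prefix n \<sigma>)" unfolding avoid_def fix_prefix_def
    using G by (auto simp: pre_def)
qed

lemma ce_fix_prefix: assumes "ce V" shows "ce (V \<union> fix_prefix n (set_decode u))"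
  unfolding fix_prefix_def
  by (rule ce_Un[OF assms]) (intro sig_dec dec_intros cpt_intros)

text \<open>Forbidding these strings forces the functional to give no bit at some argument below
  \<open>m\<close>.\<close>

definition converging :: "rf \<Rightarrow> nat \<Rightarrow> nat set" where
  "converging p m = {s. \<forall>x<m. \<exists>y<2. Ev s (rcode p) x y}"

lemma ce_converging: assumes "ce V" shows "ce (V \<union> converging p m)"
  unfolding converging_def
  by (rule ce_Un[OF assms]) (intro sig_ball sig_ex sig_conj sig_Ev cpt_intros sig_dec[OF dec_less])

text \<open>A ball without any convergent member avoids \<open>converging p m\<close> as well, and
  so would witness that the extended class is fat.\<close>

lemma nondivergent_if_not_fat:
  assumes "\<And>m. \<not> fat (V \<union> converging p m)"
  shows "nondivergent p V"
  unfolding nondivergent_def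
proof (intro allI impI, rule ccontr)
  fix E :: "nat set" and \<eta> :: ennreal and N m :: nat
  assume *: "weight E < \<infinity>" "0 < \<eta>" "wball E \<eta> N \<subseteq> avoid V"
    "\<not> (\<exists>G\<in>wball E \<eta> N. \<forall>x<m. \<exists>y\<le>1. eval (\<lambda>x. x \<in> G) p x y)"
  have "G \<in> avoid (converging p m)" if "G \<in> wball E \<eta> N" for G
    unfolding avoid_def
  proof safe
    fix n assume n: "pre G n \<in> converging p m"
    have "\<exists>y\<le>1. eval (\<lambda>x. x \<in> G) p x y" if xm: "x < m" for x
    proof -
      obtain y where "y < 2" "Ev (pre G n) (rcode p) x y" using n xm unfolding converging_def by blast
      thus ?thesis using Ev_sound[of G n p x y] by (intro exI[of _ y]) auto
    qed
    thus False using *(4) \<open>G \<in> wball E \<eta> N\<close> by blast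
  qed
  hence "wball E \<eta> N \<subseteq> avoid (V \<union> converging p m)" using *(3) by (auto simp: avoid_Un)
  hence "fat (V \<union> converging p m)" using *(1,2) unfolding fat_def by blast
  thus False using assms by blast
qed

definition out_stream :: "rf \<Rightarrow> nat set \<Rightarrow> (nat \<Rightarrow> bool) \<Rightarrow> bool" where
  "out_stream p G X \<longleftrightarrow> (\<forall>x. eval (\<lambda>x. x \<in> G) p x (of_bool (X x)))"

lemma eventually_threshold:
  fixes w :: real
  shows "\<exists>d. \<forall>h\<ge>d. 27 * real h * (1/2) ^ h \<le> (1/2) ^ a \<and> w \<le> 2 ^ h"
proof -
  have "(\<lambda>h. 27 * (real h * (1/2) ^ h)) \<longlonglongrightarrow> 27 * 0"
    by (intro tendsto_mult tendsto_const) (use powser_times_n_limit_0[of "1/2::real"] in \<open>simp add: mult.commute\<close>)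
  hence "\<forall>\<^sub>F h in sequentially. 27 * (real h * (1/2) ^ h) < (1/2) ^ a" by (rule order_tendstoD(2)) simp
  then obtain d1 where d1: "\<And>h. h \<ge> d1 \<Longrightarrow> 27 * (real h * (1/2) ^ h) < (1/2) ^ a"
    unfolding eventually_sequentially by blast
  obtain d2 where d2: "w < (2::real) ^ d2" using real_arch_pow[of 2 w] by auto
  have "w \<le> 2 ^ h" if "h \<ge> d2" for h
  proof -
    have "(2::real) ^ d2 \<le> 2 ^ h" using that by (intro power_increasing) auto
    thus ?thesis using d2 by linarith
  qed
  thus ?thesis using d1 by (intro exI[of _ "max d1 d2"]) (auto simp: mult.assoc intro: less_imp_le)
qed

text \<open>If divergence can be forced, no output is left. Otherwise the search behind the test
  succeeds for this condition, and it remains to pin a prefix on which the output runs into the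
  enumerated set.\<close>

lemma force_into_test:
  assumes hit: "captures p U"
    and V: "ce V" "fat V"
  shows "\<exists>V'. ce V' \<and> fat V' \<and> avoid V' \<subseteq> avoid V \<and> (\<forall>G\<in>avoid V'. \<forall>X. out_stream p G X \<longrightarrow> X \<in> cyl (U n))"
proof (cases "\<exists>m. fat (V \<union> converging p m)")
  case True
  then obtain m where m: "fat (V \<union> converging p m)" by blast
  have "\<not> out_stream p G X" if "G \<in> avoid (V \<union> converging p m)" for G X
  proof
    assume "out_stream p G X"
    then obtain n0 where "\<And>n x. n \<ge> n0 \<Longrightarrow> x < m \<Longrightarrow> Ev (pre G n) (rcode p) x (of_bool (X x))"
      using Ev_complete_bounded[of m G p "\<lambda>x. of_bool (X x)"] unfolding out_stream_def by blast
    hence "pre G n0 \<in> converging p m" unfolding converging_def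
      by (auto intro!: exI[of _ "of_bool (X _)"] simp: less_2_cases_iff)
    thus False using that by (auto simp: avoid_def)
  qed
  thus ?thesis using m ce_converging[OF V(1), of p m]
    by (intro exI[of _ "V \<union> converging p m"]) (auto simp: avoid_Un)
next
  case False
  hence nd: "nondivergent p V" using nondivergent_if_not_fat by blast
  obtain c where "\<And>x. x \<in> V \<longleftrightarrow> Uni c x" using ce_Uni[OF V(1)] by blast
  hence c: "V = {x. Uni c x}" by blast
  obtain K0 \<eta> N where K0: "weight K0 < \<infinity>" "0 < \<eta>" "wball K0 \<eta> N \<subseteq> avoid V" using V(2) unfolding fat_def by blast
  obtain w where w: "weight K0 = ennreal w" "0 \<le> w" using K0(1) by (cases "weight K0") auto
  \<comment> \<open>The radius is halved: one \<open>dyadic 1 a\<close> pays for the steering, the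
    other stays as the radius of the new ball.\<close>
  obtain a where a: "dyadic 2 a \<le> \<eta>"
  proof -
    have "(\<lambda>a. ennreal (2 * (1/2) ^ a)) \<longlonglongrightarrow> ennreal (2 * 0)"
      by (intro tendsto_ennrealI tendsto_mult tendsto_const LIMSEQ_realpow_zero) auto
    hence "\<forall>\<^sub>F a in sequentially. ennreal (2 * (1/2) ^ a) < \<eta>" using K0(2) by (intro order_tendstoD(2)) auto
    then obtain a where "ennreal (2 * (1/2) ^ a) < \<eta>" using eventually_happens trivial_limit_sequentially by blast
    thus thesis using that[of a] by simp
  qed
  obtain d where d: "\<And>h. h \<ge> d \<Longrightarrow> 27 * real h * (1/2) ^ h \<le> (1/2) ^ a \<and> w \<le> 2 ^ h"
    using eventually_threshold by blast
  define u where "u = set_encode (K0 \<inter> {..<N})"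
  define q where "q = \<langle>d,\<langle>c,\<langle>\<langle>N,u\<rangle>,a\<rangle>\<rangle>\<rangle>"
  define h where "h = n + q + 1"
  \<comment> \<open>The threshold \<open>d\<close> depends only on \<open>a\<close> and
    \<open>w\<close>, so it can be built into \<open>q\<close> as padding; then
    \<open>h > q \<ge> d\<close>.\<close>
  have "d \<le> h" unfolding h_def q_def using le_prod_encode_1[of d] by (simp add: add.assoc trans_le_add2 le_SucI)
  note dh = d[OF this]
  have instance_large: "instance_large p q n b l T = finitely_large (rcode p) c N (K0 \<inter> {..<N}) a h b l T" for b l T
    unfolding instance_large_def h_def by (simp add: q_def u_def)
  have "weight K0 \<le> ennreal (2 ^ h)" unfolding w(1) using dh by (intro ennreal_leI) simp
  moreover have "wball K0 (dyadic 2 a) N \<subseteq> avoid V" using wball_mono[OF a] K0(3) by blast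
  ultimately obtain b l0 T0 where b: "b < 2 ^ (2 * h)"
    "cores V (K0 \<inter> {..<N}) N (dyadic 2 a) (dyadic (Suc b) h) \<noteq> {}" "finite T0" "instance_large p q n b l0 T0"
    using finitely_large_exists[of p c K0 h a N] nd dh unfolding instance_large c by blast
  obtain l T where lT: "instance_large p q n b l T" "{bits l v | v. v < 2 ^ l \<and> v \<in> T} \<subseteq> U n"
    using hit[unfolded captures_def, rule_format, OF b(3,4) b(1)[unfolded h_def]] by (elim exE conjE)
  obtain K where K: "K \<in> cores V (K0 \<inter> {..<N}) N (dyadic 2 a) (dyadic (Suc b) h)" using b(2) by blast
  \<comment> \<open>\<open>T\<close> may differ from \<open>T0\<close>, but soundness applies to
    every set that the search can return.\<close>
  obtain m where m: "N \<le> m" "good (rcode p) N (K0 \<inter> {..<N}) a l T m K"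
    using finitely_large_sound[of "rcode p" c N "K0 \<inter> {..<N}" a h b l T K] lT(1) K unfolding instance_large c by blast
  then obtain F v where F: "F < 2 ^ m" "\<And>x. x < m \<Longrightarrow> x \<in> K \<Longrightarrow> x \<in> set_decode F"
    "\<And>x. x < N \<Longrightarrow> x \<in> set_decode F \<longleftrightarrow> x \<in> K0 \<inter> {..<N}"
    "scaled_weight m (set_decode F) K * 2 ^ a \<le> 2 ^ m" and v: "v < 2 ^ l" "v \<in> T" "out_at \<langle>m,F\<rangle> (rcode p) l (set_decode v)"
    unfolding good_def by blast
  have KN: "K \<inter> {..<N} = K0 \<inter> {..<N}" using K by (simp add: cores_def)
  have F3: "x \<in> set_decode F \<longleftrightarrow> x \<in> K" if "x < N" for x using F(3)[OF that] KN that by auto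
  define E where "E = set_decode F \<union> (K - {..<m})"
  have w1: "scaled_weight m (set_decode F) K * 2 ^ a \<le> 1 * 2 ^ m" using F(4) by simp
  have g: "E \<in> wball K (dyadic 1 a) N" "E \<inter> {..<m} = set_decode F"
    unfolding E_def by (rule graft_code[OF F(1) F(2) F3 w1 m(1)]; assumption)+
  have Fm: "set_decode F \<subseteq> {..<m}" using set_decode_bound[OF F(1)] .
  \<comment> \<open>Fixing the prefix \<open>F\<close> fixes the first \<open>l\<close> bits of the
    output, and these form a string of \<open>T\<close>.\<close>
  let ?V = "V \<union> fix_prefix m (set_decode F)"
  have "dyadic 1 a + dyadic 1 a = ennreal (real 1 * (1/2) ^ a + real 1 * (1/2) ^ a)"
    by (rule ennreal_plus[symmetric]) auto
  also have "\<dots> = dyadic 2 a" by (rule arg_cong[where f = ennreal]) simp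
  finally have dya2: "dyadic 1 a + dyadic 1 a = dyadic 2 a" .
  have "wball E (dyadic 1 a) m \<subseteq> wball K (dyadic 2 a) N"
    by (rule wball_subset[OF g(1) m(1) eq_refl[OF dya2]])
  hence "wball E (dyadic 1 a) m \<subseteq> avoid V" using K by (auto simp: cores_def)
  moreover have "wball E (dyadic 1 a) m \<subseteq> avoid (fix_prefix m (set_decode F))"
    using avoid_fix_prefix[OF Fm] g(2) by (auto simp: wball_def)
  ultimately have "wball E (dyadic 1 a) m \<subseteq> avoid ?V" by (simp add: avoid_Un)
  moreover have "weight E < \<infinity>"
  proof -
    have "weight E \<le> weight (set_decode F) + dyadic (Suc b) h"
      by (rule weight_le_Un[of _ "set_decode F" K]) (use K in \<open>auto simp: E_def cores_def\<close>)
    also have "\<dots> < \<infinity>" using weight_finite_less_top[of "set_decode F"] by simp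
    finally show ?thesis .
  qed
  moreover have "0 < dyadic 1 a" by simp
  ultimately have fatV: "fat ?V" unfolding fat_def by blast
  have hitV: "X \<in> cyl (U n)" if G: "G \<in> avoid ?V" and X: "out_stream p G X" for G X
  proof -
    have "G \<inter> {..<m} = set_decode F" using G avoid_fix_prefix[OF Fm] by (simp add: avoid_Un)
    hence "pre G m = \<langle>m,F\<rangle>" using pre_decode[OF F(1)] by blast
    hence o: "out p G l (set_decode v)" using v(3) out_at_sound[of G m p l] by simp
    have "X x = (x \<in> set_decode v)" if "x < l" for x
    proof -
      have "eval (\<lambda>x. x \<in> G) p x (of_bool (X x))" using X by (simp add: out_stream_def)
      moreover have "eval (\<lambda>x. x \<in> G) p x (of_bool (x \<in> set_decode v))" using o that by (simp add: out_def)
      ultimately have "(of_bool (X x) :: nat) = of_bool (x \<in> set_decode v)" by (rule eval_det)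
      thus ?thesis by (simp only: of_bool_eq_iff)
    qed
    moreover have "bits l v \<in> U n" using lT(2) v(1,2) by blast
    ultimately show ?thesis unfolding cyl_def by (auto simp: bits_def intro!: bexI[of _ "bits l v"])
  qed
  show ?thesis
  proof (intro exI conjI ballI allI impI)
    show "ce ?V" by (rule ce_fix_prefix[OF V(1)])
    show "fat ?V" by (rule fatV)
    show "avoid ?V \<subseteq> avoid V" by (simp add: avoid_Un)
  qed (rule hitV)
qed

text \<open>Half of the radius pays for adding a light tail of \<open>D\<close> to the core; the
  other half remains. The added part of \<open>D\<close> is then forced into every member.\<close>

lemma force_cover:
  assumes V: "ce V" "fat V" and D: "ce D" "weight D < \<infinity>"
  shows "\<exists>V'. ce V' \<and> fat V' \<and> avoid V' \<subseteq> avoid V \<and> (\<forall>G\<in>avoid V'. finite (D - G))"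
proof -
  obtain K \<eta> N where K: "weight K < \<infinity>" "0 < \<eta>" "wball K \<eta> N \<subseteq> avoid V" using V(2) unfolding fat_def by blast
  have "\<eta> / 2 + \<eta> / 2 = \<eta> * 2 / 2"
    by (simp only: mult_2_right add_divide_distrib_ennreal)
  hence \<eta>: "0 < \<eta> / 2" "\<eta> / 2 + \<eta> / 2 = \<eta>"
    using K(2) ennreal_mult_divide_eq[of 2 \<eta>] by (simp_all add: ennreal_zero_less_divide)
  obtain M where M: "N \<le> M" "weight (D - {..<M}) \<le> \<eta> / 2" using weight_tail_ge[OF D(2) \<eta>(1)] by blast
  \<comment> \<open>The strings that visibly omit an element of \<open>D\<close> beyond
    \<open>M\<close>; they form a c.e. set because \<open>D\<close> is c.e.\<close>
  define Y where "Y = {s. \<exists>x. x \<in> D \<and> M \<le> x \<and> x < pi1 s \<and> x \<notin> set_decode (pi2 s)}"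
  have Y: "G \<in> avoid Y \<longleftrightarrow> D - {..<M} \<subseteq> G" for G
  proof
    assume G: "G \<in> avoid Y"
    show "D - {..<M} \<subseteq> G"
    proof
      fix x assume x: "x \<in> D - {..<M}"
      have "pre G (Suc x) \<notin> Y" using G by (auto simp: avoid_def)
      thus "x \<in> G" using x unfolding Y_def by (auto simp: pre_def)
    qed
  qed (auto simp: avoid_def Y_def pre_def)
  have "sig (\<lambda>s. \<exists>x. x \<in> D \<and> M \<le> x \<and> x < pi1 s \<and> x \<notin> set_decode (pi2 s))"
    by (intro sig_ex sig_conj ce_sig[OF D(1)] cpt_intros sig_dec[OF dec_le] sig_dec[OF dec_less] sig_dec[OF dec_not[OF dec_mem]])
  hence ceV: "ce (V \<union> Y)" unfolding Y_def by (rule ce_Un[OF V(1)])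
  define E where "E = K \<union> (D - {..<M})"
  have "weight (E - K) \<le> weight (D - {..<M})" by (rule weight_mono) (auto simp: E_def)
  hence "E \<in> wball K (\<eta> / 2) N" using M by (auto simp: wball_def E_def)
  hence "wball E (\<eta> / 2) N \<subseteq> wball K \<eta> N" using wball_subset[of E K "\<eta> / 2" N N "\<eta> / 2" \<eta>] \<eta>(2) by simp
  hence "wball E (\<eta> / 2) N \<subseteq> avoid V" using K(3) by (rule order_trans)
  moreover have "wball E (\<eta> / 2) N \<subseteq> avoid Y"
  proof
    fix G assume "G \<in> wball E (\<eta> / 2) N"
    hence "D - {..<M} \<subseteq> G" by (simp add: wball_def E_def)
    thus "G \<in> avoid Y" unfolding Y .
  qed
  ultimately have "wball E (\<eta> / 2) N \<subseteq> avoid (V \<union> Y)" by (simp add: avoid_Un)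
  moreover have "weight E < \<infinity>"
  proof -
    have "weight E \<le> weight K + weight D" by (rule weight_le_Un[of _ K D]) (auto simp: E_def)
    thus ?thesis using K(1) D(2) by (simp add: order.strict_trans1)
  qed
  ultimately have "fat (V \<union> Y)" using \<eta>(1) unfolding fat_def by blast
  moreover have "finite (D - G)" if "G \<in> avoid (V \<union> Y)" for G
  proof -
    have "D - {..<M} \<subseteq> G" using that by (simp add: avoid_Un Y)
    hence "D - G \<subseteq> {..<M}" by auto
    thus ?thesis using finite_subset by blast
  qed
  ultimately show ?thesis using ceV by (intro exI[of _ "V \<union> Y"]) (auto simp: avoid_Un)
qed

text \<open>Fixing ever longer prefixes lets a nested sequence of classes determine a single
  set.\<close>

lemma force_prefix:
  assumes V: "ce V" "fat V"
  shows "\<exists>V'. ce V' \<and> fat V' \<and> avoid V' \<subseteq> avoid V \<and> (\<exists>\<sigma>. \<forall>G\<in>avoid V'. G \<inter> {..<n} = \<sigma>)"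
proof -
  obtain K \<eta> N where K: "weight K < \<infinity>" "0 < \<eta>" "wball K \<eta> N \<subseteq> avoid V" using V(2) unfolding fat_def by blast
  let ?V = "V \<union> fix_prefix n (set_decode (set_encode (K \<inter> {..<n})))"
  have eq: "set_decode (set_encode (K \<inter> {..<n})) = K \<inter> {..<n}" by simp
  have "wball K \<eta> (max n N) \<subseteq> wball K \<eta> N" 
    by (rule wball_subset[OF wball_self[of K 0 N]]) auto
  moreover have "G \<in> avoid (fix_prefix n (K \<inter> {..<n}))" if "G \<in> wball K \<eta> (max n N)" for G
  proof -
    have "G \<inter> {..<n} = K \<inter> {..<n}" 
      using Int_lessThan_mono[of G "max n N" K n] that by (simp add: wball_def)
    thus ?thesis using avoid_fix_prefix[of "K \<inter> {..<n}" n] by simp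
  qed
  ultimately have "wball K \<eta> (max n N) \<subseteq> avoid ?V" using K(3) unfolding avoid_Un eq by blast
  hence fatV: "fat ?V" using K(1,2) unfolding fat_def by blast
  have "\<forall>G\<in>avoid ?V. G \<inter> {..<n} = K \<inter> {..<n}"
    unfolding avoid_Un eq using avoid_fix_prefix[of "K \<inter> {..<n}" n] by simp
  note pV = this
  show ?thesis
  proof (intro exI conjI)
    show "ce ?V" by (rule ce_fix_prefix[OF V(1)])
    show "fat ?V" by (rule fatV)
    show "avoid ?V \<subseteq> avoid V" by (simp add: avoid_Un)
    show "\<forall>G\<in>avoid ?V. G \<inter> {..<n} = K \<inter> {..<n}" by (rule pV)
  qed
qed

lemma avoid_nonempty: "fat V \<Longrightarrow> avoid V \<noteq> {}"
  unfolding fat_def using wball_self by blast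

section \<open>The initial condition and the generic set\<close>

lemma rcode_inj: "rcode p = rcode q \<Longrightarrow> p = q"
proof (induction p arbitrary: q)
  case Zero thus ?case by (cases q) auto
next
  case Succ thus ?case by (cases q) auto
next
  case Fst thus ?case by (cases q) auto
next
  case Snd thus ?case by (cases q) auto
next
  case Orc thus ?case by (cases q) auto
next
  case (Comp p1 p2) thus ?case by (cases q) auto
next
  case (Pair p1 p2) thus ?case by (cases q) auto
next
  case (Prec p1 p2) thus ?case by (cases q) auto
next
  case (Mu p) thus ?case by (cases q) auto
qed

lemma inv_rcode: "inv rcode (rcode p) = p"
  using rcode_inj by (intro inv_f_f injI)

text \<open>A sum of nonnegative terms is the supremum of its finite partial sums, and these are
  weights of finite sets; the converse bound passes through prefixes.\<close>

lemma wt_eq_weight: "wt X = weight (prod_encode ` X)"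
proof (rule antisym)
  have w: "sum (\<lambda>(n, m). ennreal ((1/2) ^ n)) F = weight (prod_encode ` F)" if "finite F" for F
    using that by (simp add: weight_finite sum.reindex inj_on_def case_prod_unfold)
  have eq: "wt X = (SUP F\<in>{F. finite F \<and> F \<subseteq> X}. sum (\<lambda>(n, m). ennreal ((1/2) ^ n)) F)"
    unfolding wt_def by (rule nonneg_infsum_complete) auto
  show "wt X \<le> weight (prod_encode ` X)"
    unfolding eq by (rule SUP_least) (auto simp: w intro!: weight_mono)
  show "weight (prod_encode ` X) \<le> wt X"
  proof (rule weight_le_prefix)
    fix n
    define F where "F = prod_decode ` (prod_encode ` X \<inter> {..<n})"
    have F: "finite F" "F \<subseteq> X" "prod_encode ` F = prod_encode ` X \<inter> {..<n}"
      by (auto simp: F_def image_image)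
    have "weight (prod_encode ` X \<inter> {..<n}) = sum (\<lambda>(n, m). ennreal ((1/2) ^ n)) F" unfolding w[OF F(1)] F(3) ..
    also have "\<dots> \<le> wt X" unfolding eq using F(1,2) by (intro SUP_upper) auto
    finally show "weight (prod_encode ` X \<inter> {..<n}) \<le> wt X" .
  qed
qed

text \<open>The initial condition, which guarantees that the final set has finite weight. The ball
  of radius 1 around the empty set shows that it is fat.\<close>

lemma weight_le_1_class: "\<exists>V. ce V \<and> fat V \<and> (\<forall>G\<in>avoid V. weight G \<le> 1)"
proof -
  let ?V = "{s. 2 ^ pi1 s < scaled_weight (pi1 s) (set_decode (pi2 s)) {}}"
  have iff: "pre G n \<notin> ?V \<longleftrightarrow> weight (G \<inter> {..<n}) \<le> 1" for G n
  proof -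
    have "weight (G \<inter> {..<n}) \<le> 1 \<longleftrightarrow> scaled_weight n G {} * 2 ^ 0 \<le> 1 * 2 ^ n"
      using weight_le_iff_scaled_weight[of G "{}" n 1 0] by simp
    also have "scaled_weight n G {} = scaled_weight n (G \<inter> {..<n}) {}" by (rule scaled_weight_cong) auto
    finally show ?thesis by (simp add: pre_def not_less)
  qed
  have *: "avoid ?V = {G. weight G \<le> 1}"
  proof (intro set_eqI iffI)
    fix G assume "G \<in> avoid ?V"
    hence "weight (G \<inter> {..<n}) \<le> 1" for n using iff unfolding avoid_def by blast
    thus "G \<in> {G. weight G \<le> 1}" using weight_le_prefix by simp
  next
    fix G assume "G \<in> {G. weight G \<le> 1}"
    hence "weight (G \<inter> {..<n}) \<le> 1" for n using weight_mono[of "G \<inter> {..<n}" G] by auto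
    thus "G \<in> avoid ?V" using iff unfolding avoid_def by blast
  qed
  have "ce ?V" unfolding scaled_weight_def
    by (intro sig_imp_ce sig_dec dec_intros dec_empty cpt_intros)
  moreover have "wball {} 1 0 \<subseteq> avoid ?V" unfolding * by (auto simp: wball_def)
  hence "fat ?V" unfolding fat_def by (intro exI[of _ "{}"] exI[of _ 1] exI[of _ 0]) simp
  ultimately show ?thesis using * by blast
qed

text \<open>Stage \<open>i\<close> serves three requirements: the prefix of length \<open>i\<close>,
  the \<open>i\<close>-th c.e. set, and the pair of program and test level coded by
  \<open>i\<close>. Closedness puts the limit set into all the classes.\<close>

lemma generic_exists:
  assumes V0: "ce V0" "fat V0"
    and hit: "\<And>p. captures p (U p)"
  shows "\<exists>G\<in>avoid V0. (\<forall>D. ce D \<and> weight D < \<infinity> \<longrightarrow> finite (D - G)) \<and>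
    (\<forall>p X. out_stream p G X \<longrightarrow> (\<forall>n. X \<in> cyl (U p n)))"
proof -
  define meets where "meets i V \<longleftrightarrow> (\<exists>\<sigma>. \<forall>G\<in>avoid V. G \<inter> {..<i} = \<sigma>) \<and>
      (weight {x. Uni i x} < \<infinity> \<longrightarrow> (\<forall>G\<in>avoid V. finite ({x. Uni i x} - G))) \<and>
      (\<forall>G\<in>avoid V. \<forall>X. out_stream (inv rcode (pi1 i)) G X \<longrightarrow> X \<in> cyl (U (inv rcode (pi1 i)) (pi2 i)))" for i V
  have step: "\<exists>V'. (ce V' \<and> fat V') \<and> (avoid V' \<subseteq> avoid V \<and> meets i V')" if V: "ce V" "fat V" for i V
  proof -
    obtain V1 where V1: "ce V1" "fat V1" "avoid V1 \<subseteq> avoid V" "\<exists>\<sigma>. \<forall>G\<in>avoid V1. G \<inter> {..<i} = \<sigma>"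
      using force_prefix[OF V, of i] by metis
    have "\<exists>V2. ce V2 \<and> fat V2 \<and> avoid V2 \<subseteq> avoid V1 \<and>
      (weight {x. Uni i x} < \<infinity> \<longrightarrow> (\<forall>G\<in>avoid V2. finite ({x. Uni i x} - G)))"
    proof (cases "weight {x. Uni i x} < \<infinity>")
      case True
      have "ce {x. Uni i x}" by (intro sig_imp_ce sig_Uni cpt_intros)
      from force_cover[OF V1(1,2) this True] show ?thesis by metis
    qed (use V1 in auto)
    then obtain V2 where V2: "ce V2" "fat V2" "avoid V2 \<subseteq> avoid V1"
      "weight {x. Uni i x} < \<infinity> \<longrightarrow> (\<forall>G\<in>avoid V2. finite ({x. Uni i x} - G))" by (elim exE conjE)
    obtain V3 where V3: "ce V3" "fat V3" "avoid V3 \<subseteq> avoid V2"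
      "\<forall>G\<in>avoid V3. \<forall>X. out_stream (inv rcode (pi1 i)) G X \<longrightarrow> X \<in> cyl (U (inv rcode (pi1 i)) (pi2 i))"
      using force_into_test[OF hit V2(1,2), of "inv rcode (pi1 i)" "pi2 i"] by (elim exE conjE)
    have "meets i V3" unfolding meets_def
    proof (intro conjI impI)
      show "\<exists>\<sigma>. \<forall>G\<in>avoid V3. G \<inter> {..<i} = \<sigma>" using V1(4) V2(3) V3(3) by (meson subsetD)
      show "\<forall>G\<in>avoid V3. finite ({x. Uni i x} - G)" if "weight {x. Uni i x} < \<infinity>"
        using V2(4) that V3(3) by (meson subsetD)
    qed (rule V3(4))
    moreover have "avoid V3 \<subseteq> avoid V" using V3(3) V2(3) V1(3) by (meson order_trans)
    ultimately show ?thesis using V3(1,2) by (intro exI[of _ V3]) simp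
  qed
  have "\<exists>f. \<forall>n. (ce (f n) \<and> fat (f n) \<and> (n = 0 \<longrightarrow> f n = V0)) \<and> (avoid (f (Suc n)) \<subseteq> avoid (f n) \<and> meets n (f (Suc n)))"
  proof (rule dependent_nat_choice)
    show "\<exists>V. ce V \<and> fat V \<and> (0 = 0 \<longrightarrow> V = V0)" using V0 by simp
  next
    fix V and i :: nat assume "ce V \<and> fat V \<and> (i = 0 \<longrightarrow> V = V0)"
    thus "\<exists>V'. (ce V' \<and> fat V' \<and> (Suc i = 0 \<longrightarrow> V' = V0)) \<and> avoid V' \<subseteq> avoid V \<and> meets i V'"
      using step[of V i] by simp
  qed
  then obtain f where f: "\<And>n. fat (f n)" "f 0 = V0" "\<And>n. avoid (f (Suc n)) \<subseteq> avoid (f n)" "\<And>n. meets n (f (Suc n))"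
    by auto
  have anti: "avoid (f n) \<subseteq> avoid (f m)" if "m \<le> n" for m n
    using lift_Suc_antimono_le[of "\<lambda>n. avoid (f n)", OF f(3) that] .
  \<comment> \<open>The class \<open>f (Suc (Suc x))\<close> meets requirement \<open>Suc x\<close>,
    so its members share the prefix of length \<open>Suc x\<close> and agree on
    \<open>x\<close>.\<close>
  define G where "G = {x. \<forall>H\<in>avoid (f (Suc (Suc x))). x \<in> H}"
  have agree: "x \<in> H \<longleftrightarrow> x \<in> G" if H: "H \<in> avoid (f (Suc i))" and x: "x < i" for H i x
  proof -
    have H': "H \<in> avoid (f (Suc (Suc x)))" using anti[of "Suc (Suc x)" "Suc i"] H x by auto
    obtain \<sigma> where \<sigma>: "\<forall>H\<in>avoid (f (Suc (Suc x))). H \<inter> {..<Suc x} = \<sigma>"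
      using f(4)[of "Suc x"] unfolding meets_def by (elim conjE exE)
    have mem: "x \<in> H' \<longleftrightarrow> x \<in> \<sigma>" if "H' \<in> avoid (f (Suc (Suc x)))" for H'
      using \<sigma>[rule_format, OF that] by auto
    show ?thesis unfolding G_def using mem H' by auto
  qed
  have GV: "G \<in> avoid (f i)" for i
    unfolding avoid_def
  proof safe
    fix n assume bad: "pre G n \<in> f i"
    \<comment> \<open>A member of a late class shares the allegedly forbidden prefix with
      \<open>G\<close>, yet it also lies in \<open>avoid (f i)\<close>.\<close>
    obtain H where H: "H \<in> avoid (f (Suc (max i n)))" using avoid_nonempty[OF f(1)] by blast
    have "pre H n = pre G n" unfolding pre_eq_iff using agree[OF H] by auto
    moreover have "i \<le> Suc (max i n)" by simp
    from anti[OF this] H have "H \<in> avoid (f i)" by (rule subsetD)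
    ultimately show False using bad unfolding avoid_def by (metis (mono_tags, lifting) mem_Collect_eq)
  qed
  have "finite (D - G)" if D: "ce D" "weight D < \<infinity>" for D
  proof -
    obtain c where "\<And>x. x \<in> D \<longleftrightarrow> Uni c x" using ce_Uni[OF D(1)] by blast
    hence "D = {x. Uni c x}" by blast
    thus ?thesis using f(4)[of c] GV[of "Suc c"] D(2) unfolding meets_def by simp
  qed
  moreover have "X \<in> cyl (U p n)" if "out_stream p G X" for p X n
  proof -
    have "\<forall>G\<in>avoid (f (Suc \<langle>rcode p,n\<rangle>)). \<forall>X. out_stream p G X \<longrightarrow> X \<in> cyl (U p n)"
      using f(4)[of "\<langle>rcode p,n\<rangle>"] unfolding meets_def prod_encode_inverse fst_conv snd_conv inv_rcode
      by (elim conjE)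
    thus ?thesis using GV that by blast
  qed
  ultimately show ?thesis using GV[of 0] f(2) by (intro bexI[of _ G]) auto
qed

theorem theorem2p1:
  shows "\<exists>G :: (nat \<times> nat) set. wt G < \<infinity> \<and>
           (\<forall>D. ce_pairs D \<and> wt D < \<infinity> \<longrightarrow> finite (D - G)) \<and>
           \<not> (\<exists>X. turing_computes G X \<and> mlof_random X)"
proof -
  \<comment> \<open>Every functional gets its own test, chosen before \<open>G\<close> is
    built.\<close>
  have "\<forall>p. \<exists>U. mlof_test U \<and> captures p U" using capturing_test_exists by blast
  from choice[OF this] obtain U where U: "\<And>p. mlof_test (U p)" "\<And>p. captures p (U p)" by blast
  obtain V0 where V0: "ce V0" "fat V0" "\<And>G. G \<in> avoid V0 \<Longrightarrow> weight G \<le> 1" using weight_le_1_class by blast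
  have "\<exists>G\<in>avoid V0. (\<forall>D. ce D \<and> weight D < \<infinity> \<longrightarrow> finite (D - G)) \<and>
    (\<forall>p X. out_stream p G X \<longrightarrow> (\<forall>n. X \<in> cyl (U p n)))"
    by (rule generic_exists[OF V0(1,2)]) (rule U(2))
  then obtain G where G: "G \<in> avoid V0" "\<And>D. ce D \<Longrightarrow> weight D < \<infinity> \<Longrightarrow> finite (D - G)"
    "\<And>p X n. out_stream p G X \<Longrightarrow> X \<in> cyl (U p n)" by blast
  define H where "H = prod_decode ` G"
  have img: "prod_encode ` H = G" by (simp add: H_def image_image)
  have "wt H < \<infinity>" unfolding wt_eq_weight img using V0(3)[OF G(1)] by (simp add: order.strict_trans1)
  moreover have "finite (D - H)" if D: "ce_pairs D" "wt D < \<infinity>" for D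
  proof -
    have "prod_encode ` (D - H) = prod_encode ` D - G"
      unfolding img[symmetric] by (intro image_set_diff inj_prod_encode)
    moreover have "finite (prod_encode ` D - G)" using D G(2) by (simp add: ce_pairs_def wt_eq_weight)
    ultimately show ?thesis using finite_imageD[of prod_encode "D - H"] inj_prod_encode by (metis inj_on_subset subset_UNIV)
  qed
  moreover have "\<not> mlof_random X" if X: "turing_computes H X" for X
  proof -
    have "pair_oracle H = (\<lambda>x. x \<in> G)"
    proof
      fix x
      show "pair_oracle H x = (x \<in> G)" unfolding pair_oracle_def img[symmetric]
        by (metis imageE imageI prod_decode_inverse prod_encode_inverse)
    qed
    then obtain p where "\<forall>n. eval (\<lambda>x. x \<in> G) p n (if X n then 1 else 0)"
      using X unfolding turing_computes_def by auto
    hence "out_stream p G X" by (simp add: out_stream_def of_bool_def)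
    hence "\<forall>n. X \<in> cyl (U p n)" using G(3) by blast
    thus ?thesis using U(1) unfolding mlof_random_def by blast
  qed
  ultimately show ?thesis by blast
qed

end
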